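(* For every integer $n\ge 0$, the genus distribution $g_0(RL_n), g_1(RL_n), g_2(RL_n),\ldots$ of the Ringel ladder $RL_n$ is log-concave; that is, $g_{k-1}(RL_n)\,g_{k+1}(RL_n)\le g_k(RL_n)^2$ for all $k\ge 1$.
   Context: Graphs are finite and connected, and multiple edges are allowed. Embeddings are cellular embeddings in closed orientable surfaces. For a graph $G$, $g_i(G)$ denotes the number of combinatorially distinct embeddings of $G$ in the orientable surface $S_i$ of genus $i$; embeddings are counted as rotation systems of $G$ (an assignment to each vertex of a cyclic ordering of the edge-ends at that vertex), so the total number of embeddings is $\prod_v (\deg v-1)!$. The sequence $g_0(G),g_1(G),g_2(G),\ldots$ is the genus distribution of $G$. Symmetric ladder: for $n\ge 0$, $(\ddot L_n,u,v)$ is the graph obtained from the Cartesian product $P_2\,\Box\,P_{n+2}$ of paths (where $P_m$ is the path on $m$ vertices) by contracting the rung (copy of the edge of $P_2$) at each of the two ends of the ladder (the end edges joining a pair of 2-valent vertices). The two resulting 2-valent vertices at the two ends are the root-vertices $u$ and $v$. (Thus $\ddot L_n$ has $n$ rungs; $\ddot L_0$ is the graph on two vertices $u,v$ joined by two parallel edges.) Ringel ladder: $RL_n$ is the graph obtained from $(\ddot L_n,u,v)$ by adding one new edge joining $u$ to $v$ (this operation is called self-bar-amalgamation). *)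

theory Defs
  imports "Graph_Theory.Digraph" "HOL-Combinatorics.Permutations" "HOL-Combinatorics.Orbits"
begin

text \<open>
  An undirected multigraph is represented by a digraph with exactly one arc for each edge. The
  direction of an arc is an arbitrary reference orientation: it only serves to name the two ends
  of the edge \<open>e\<close> (also when \<open>e\<close> is a loop), namely \<open>(e, False)\<close> at the tail and \<open>(e, True)\<close> at the
  head of \<open>e\<close>.
\<close>

definition edge_ends :: "('a, 'b) pre_digraph \<Rightarrow> ('b \<times> bool) set" where
  "edge_ends G = arcs G \<times> UNIV"

fun end_vertex :: "('a, 'b) pre_digraph \<Rightarrow> 'b \<times> bool \<Rightarrow> 'a" where
  "end_vertex G (e, False) = tail G e"
| "end_vertex G (e, True) = head G e"

definition ends_at :: "('a, 'b) pre_digraph \<Rightarrow> 'a \<Rightarrow> ('b \<times> bool) set" where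
  "ends_at G v = {d \<in> edge_ends G. end_vertex G d = v}"

fun opposite_end :: "'b \<times> bool \<Rightarrow> 'b \<times> bool" where
  "opposite_end (e, b) = (e, \<not> b)"


text \<open>
  The cyclic orderings at all vertices are packed into a single permutation of the edge-ends,
  sending each edge-end to its successor in the cyclic ordering at its vertex. The definitions
  below are meant for connected graphs with at least one edge.
\<close>

definition rotation_system :: "('a, 'b) pre_digraph \<Rightarrow> ('b \<times> bool \<Rightarrow> 'b \<times> bool) \<Rightarrow> bool" where
  "rotation_system G \<rho> \<longleftrightarrow>
     \<rho> permutes edge_ends G \<and> (\<forall>v \<in> verts G. cyclic_on \<rho> (ends_at G v))"

text \<open>
  Face tracing: a facial walk leaving along the edge-end \<open>d\<close> arrives at \<open>opposite_end d\<close> and leaves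
  again along the next edge-end in the rotation there.
\<close>

definition faces :: "('a, 'b) pre_digraph \<Rightarrow> ('b \<times> bool \<Rightarrow> 'b \<times> bool) \<Rightarrow> ('b \<times> bool) set set" where
  "faces G \<rho> = orbit (\<rho> \<circ> opposite_end) ` edge_ends G"

text \<open>
  The cellular embedding given by a rotation system lies in the closed orientable surface of
  genus \<open>i\<close>, which has Euler characteristic \<open>2 - 2 i\<close>.
\<close>

definition embeds_in_genus ::
    "('a, 'b) pre_digraph \<Rightarrow> ('b \<times> bool \<Rightarrow> 'b \<times> bool) \<Rightarrow> nat \<Rightarrow> bool" where
  "embeds_in_genus G \<rho> i \<longleftrightarrow>
     int (card (verts G)) - int (card (arcs G)) + int (card (faces G \<rho>)) = 2 - 2 * int i"

definition genus_distribution :: "('a, 'b) pre_digraph \<Rightarrow> nat \<Rightarrow> nat" where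
  "genus_distribution G i = card {\<rho>. rotation_system G \<rho> \<and> embeds_in_genus G \<rho> i}"

definition log_concave :: "(nat \<Rightarrow> nat) \<Rightarrow> bool" where
  "log_concave a \<longleftrightarrow> (\<forall>k \<ge> 1. a (k - 1) * a (k + 1) \<le> (a k)\<^sup>2)"


definition path_graph :: "nat \<Rightarrow> (nat, nat) pre_digraph" where
  "path_graph m =
     \<lparr>verts = {i. i < m}, arcs = {i. Suc i < m}, tail = (\<lambda>i. i), head = (\<lambda>i. Suc i)\<rparr>"

text \<open>\<open>Inl (a, w)\<close> is the copy of the edge \<open>a\<close> of the first factor over the vertex \<open>w\<close> of the second.\<close>

definition cartesian_product ::
    "('a, 'b) pre_digraph \<Rightarrow> ('c, 'd) pre_digraph
      \<Rightarrow> ('a \<times> 'c, ('b \<times> 'c) + ('a \<times> 'd)) pre_digraph" where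
  "cartesian_product G H =
     \<lparr>verts = verts G \<times> verts H,
      arcs = (arcs G \<times> verts H) <+> (verts G \<times> arcs H),
      tail = case_sum (\<lambda>(a, w). (tail G a, w)) (\<lambda>(v, b). (v, tail H b)),
      head = case_sum (\<lambda>(a, w). (head G a, w)) (\<lambda>(v, b). (v, head H b))\<rparr>"

text \<open>Contracting \<open>e\<close> identifies its two endpoints; the merged vertex is called \<open>tail G e\<close>.\<close>

definition contract_edge :: "('a, 'b) pre_digraph \<Rightarrow> 'b \<Rightarrow> ('a, 'b) pre_digraph" where
  "contract_edge G e =
     (let merge = (\<lambda>v. if v = head G e then tail G e else v) in
      \<lparr>verts = merge ` verts G,
       arcs = arcs G - {e},
       tail = merge \<circ> tail G,
       head = merge \<circ> head G\<rparr>)"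

definition add_new_edge :: "('a, 'b) pre_digraph \<Rightarrow> 'a \<Rightarrow> 'a \<Rightarrow> ('a, 'b option) pre_digraph" where
  "add_new_edge G u v =
     \<lparr>verts = verts G,
      arcs = insert None (Some ` arcs G),
      tail = case_option u (tail G),
      head = case_option v (head G)\<rparr>"

type_synonym ladder_vertex = "nat \<times> nat"
type_synonym ladder_edge = "(nat \<times> nat) + (nat \<times> nat)"

definition rung :: "nat \<Rightarrow> ladder_edge" where
  "rung j = Inl (0, j)"

definition symmetric_ladder :: "nat \<Rightarrow> (ladder_vertex, ladder_edge) pre_digraph" where
  "symmetric_ladder n =
     contract_edge
       (contract_edge (cartesian_product (path_graph 2) (path_graph (n + 2))) (rung 0))
       (rung (n + 1))"

text \<open>The root-vertices are the vertices to which the two end rungs have been contracted.\<close>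

definition root_u :: ladder_vertex where
  "root_u = (0, 0)"

definition root_v :: "nat \<Rightarrow> ladder_vertex" where
  "root_v n = (0, n + 1)"

definition ringel_ladder :: "nat \<Rightarrow> (ladder_vertex, ladder_edge option) pre_digraph" where
  "ringel_ladder n = add_new_edge (symmetric_ladder n) root_u (root_v n)"

end

theory Submission
  imports Defs
begin

text \<open>
  A Ringel ladder is 3-regular, so a rotation system is a choice, at each of its \<open>2 n + 2\<close> vertices, of
  one of two cyclic orders. Cut the ladder between two consecutive rungs. Three edges cross the cut:
  the two rails and the edge that joins the roots (the handle). For counting faces, all that matters
  about the part to the left of the cut is the number of faces that it has closed already and the
  permutation \<open>\<pi>\<close> of the three strands which tells along which strand a facial walk leaves this part
  after having entered it along a given strand. Adding the next rung joins two corners that lie on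
  facial walks leaving along strands \<open>X\<close> and \<open>Y\<close>: if \<open>X \<noteq> Y\<close>, the two walks exchange their exits, and if
  \<open>X = Y\<close>, a closed face is split off. So \<open>\<pi>\<close> becomes \<open>transpose X Y \<circ> \<pi>\<close>
  (\<open>bypass_passed_ends\<close>, \<open>cycle_count_ends_from\<close>).
  
  Only six permutations occur, and the resulting linear recurrences for the numbers of orientations
  with a given number of faces can be solved (\<open>swap_count_eq\<close>, \<open>spin_count_eq\<close>). With
  \<open>D k = (n - k choose k) + (n + 1 - k choose k)\<close> and \<open>D (- 1) = 0\<close> the number of embeddings in the
  surface of genus \<open>k\<close> is
  
  \<open>g k = 8 ^ k * D k + (2 ^ (n + k) - 8 ^ (k - 1)) * D (k - 1)\<close>.
  
  It remains to see that \<open>g k / 2 ^ k = 4 ^ k * D k + F k * D (k - 1)\<close> is log-concave, where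
  \<open>F k = 2 ^ n - 4 ^ k / 8\<close>. Both summands are log-concave where they matter, but this does not carry
  over to sums: the mixed term may be negative. Let \<open>j = n + 1 - 2 k\<close>, the distance from the top of the
  support of \<open>D\<close>. For \<open>j \<le> 5\<close> the sequence \<open>D\<close> falls off so fast that \<open>D (k + 1) * D (k - 2)\<close> is small
  against \<open>D k * D (k - 1)\<close>, and the mixed term is nonnegative (\<open>ladder_coeff_cross\<close>). For \<open>j \<ge> 6\<close> the
  factor \<open>4 ^ k\<close> is smaller than \<open>2 ^ n\<close> by the exponential factor \<open>2 ^ (1 - j)\<close>, and the mixed term is
  dominated by the gain from \<open>D (k - 2) * D k \<le> (1 - 1 / k) * (D (k - 1))\<^sup>2\<close>
  (\<open>ladder_coeff_strict_log_concave\<close>).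
\<close>


section \<open>Counting the cycles of a permutation by short-circuiting points\<close>

definition cycle_count :: "('a \<Rightarrow> 'a) \<Rightarrow> 'a set \<Rightarrow> nat" where
  "cycle_count p S = card (orbit p ` S)"

text \<open>
  For a permutation \<open>p\<close> of a set \<open>S\<close> that contains \<open>x\<close>, this is the first-return map to \<open>S - {x}\<close>.
\<close>

definition bypass :: "'a \<Rightarrow> ('a \<Rightarrow> 'a) \<Rightarrow> 'a \<Rightarrow> 'a" where
  "bypass x p y = (if p y = x then p x else p y)"

text \<open>
  When the points of the list are short-circuited one after the other, a cycle disappears exactly if
  its last remaining point, by then a fixed point, is removed.
\<close>

primrec closed_loops :: "'a list \<Rightarrow> ('a \<Rightarrow> 'a) \<Rightarrow> nat" where
  "closed_loops [] p = 0"
| "closed_loops (x # xs) p = (if p x = x then 1 else 0) + closed_loops xs (bypass x p)"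

lemma in_own_orbit:
  assumes "bij_betw p S S" "finite S" "y \<in> S"
  shows "y \<in> orbit p y"
proof -
  have perm: "perm_restrict p S permutes S"
  proof (rule bij_imp_permutes)
    show "bij_betw (perm_restrict p S) S S"
      using assms(1) by (subst bij_betw_cong[of S _ p]) (auto simp: perm_restrict_def)
  qed (simp add: perm_restrict_def)
  have eq: "orbit p y = orbit (perm_restrict p S) y"
  proof (rule orbit_cong0)
    show "y \<in> S" by fact
    show "p \<in> S \<rightarrow> S" using assms(1) by (auto simp: bij_betw_def)
  qed (auto simp: perm_restrict_def)
  show ?thesis unfolding eq
    using perm assms(2) by (intro permutation_self_in_orbit) (auto simp: permutation_permutes)
qed

text \<open>
  In the second inclusion, an orbit of \<open>p\<close> that runs into \<open>x\<close> is followed with one step of delay: while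
  it stays at \<open>x\<close>, the invariant is about \<open>p x\<close>.
\<close>

lemma orbit_bypass:
  assumes "inj_on p S" "p ` S \<subseteq> S" "x \<in> S" "y \<in> S - {x}"
  shows "orbit (bypass x p) y = orbit p y - {x}"
proof (intro equalityI subsetI)
  have stays: "bypass x p z \<in> S - {x}" if "z \<in> S - {x}" for z
    using that assms by (auto simp: bypass_def inj_on_eq_iff)
  fix w assume "w \<in> orbit (bypass x p) y"
  then have "w \<in> orbit p y \<and> w \<in> S - {x}"
  proof induction
    case base
    then show ?case
      using stays[OF assms(4)] orbit.base[of p y] orbit.step[of x p y] by (auto simp: bypass_def)
  next
    case (step w)
    then show ?case
      using stays[of w] orbit.step[of w p y] orbit.step[of x p y] by (auto simp: bypass_def)
  qed
  then show "w \<in> orbit p y - {x}" by simp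
next
  fix w assume w: "w \<in> orbit p y - {x}"
  from w have "w \<in> orbit p y" by simp
  then have "(w \<noteq> x \<longrightarrow> w \<in> orbit (bypass x p) y) \<and> (w = x \<longrightarrow> p x \<in> orbit (bypass x p) y)"
  proof induction
    case base
    show ?case using orbit.base[of "bypass x p" y] by (auto simp: bypass_def[of x p y])
  next
    case (step w)
    show ?case
    proof (cases "w = x")
      case False
      with step.IH have "w \<in> orbit (bypass x p) y" by simp
      from orbit.step[OF this] show ?thesis by (auto simp: bypass_def[of x p w])
    qed (use step.IH in auto)
  qed
  with w show "w \<in> orbit (bypass x p) y" by simp
qed

lemma bij_betw_bypass:
  assumes "bij_betw p S S" "finite S" "x \<in> S"
  shows "bij_betw (bypass x p) (S - {x}) (S - {x})"
proof -
  have inj: "inj_on p S" and im: "p ` S = S"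
    using assms(1) by (auto simp: bij_betw_def)
  have "bypass x p ` (S - {x}) \<subseteq> S - {x}"
    using im assms(3) inj by (auto simp: bypass_def inj_on_eq_iff)
  moreover have "inj_on (bypass x p) (S - {x})"
    using inj assms(3) by (auto simp: inj_on_def bypass_def split: if_splits)
  ultimately show ?thesis
    using assms(2) by (simp add: bij_betw_def endo_inj_surj)
qed

text \<open>
  Removing \<open>x\<close> from its cycle leaves all cycles distinct and nonempty, unless \<open>x\<close> is a cycle by itself.
\<close>

lemma cycle_count_bypass:
  assumes p: "bij_betw p S S" "finite S" and x: "x \<in> S"
  shows "cycle_count p S = (if p x = x then 1 else 0) + cycle_count (bypass x p) (S - {x})"
proof -
  have inj: "inj_on p S" and im: "p ` S = S"
    using p(1) by (auto simp: bij_betw_def)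
  have shrink: "orbit (bypass x p) y = orbit p y - {x}" if "y \<in> S - {x}" for y
    using that orbit_bypass[OF inj _ x] im by blast
  have self: "y \<in> orbit p y" if "y \<in> S" for y
    using that in_own_orbit p by metis
  have eqI: "orbit p y = orbit p z" if "y \<in> orbit p z" "y \<in> S" "z \<in> S" for y z
    using that by (metis self orbit_cyclic_eq3 cyclic_on_def)
  show ?thesis
  proof (cases "p x = x")
    case True
    then have ox: "orbit p x = {x}" by (simp add: orbit_eq_singleton_iff)
    have no: "x \<notin> orbit p y" if "y \<in> S - {x}" for y
      using that eqI[of x y] x ox self[of y] by auto
    have "orbit p ` S = insert {x} (orbit p ` (S - {x}))"
      using x ox by auto
    moreover have "orbit p ` (S - {x}) = orbit (bypass x p) ` (S - {x})"
      using no shrink by (intro image_cong) auto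
    moreover have "{x} \<notin> orbit p ` (S - {x})"
      using no by auto
    ultimately show ?thesis
      using True p(2) by (simp add: cycle_count_def)
  next
    case False
    have "orbit p (p x) = orbit p x"
      using eqI[of "p x" x] x im by (auto intro: orbit.base)
    moreover have "p x \<in> S - {x}" using False x im by auto
    ultimately have "orbit p x \<in> orbit p ` (S - {x})" by (metis imageI)
    then have im': "orbit p ` S = orbit p ` (S - {x})" by auto
    have "inj_on (\<lambda>C. C - {x}) (orbit p ` (S - {x}))"
    proof (rule inj_onI)
      fix C D assume "C \<in> orbit p ` (S - {x})" "D \<in> orbit p ` (S - {x})"
        and eq: "C - {x} = D - {x}"
      then obtain y z where yz: "C = orbit p y" "D = orbit p z" "y \<in> S - {x}" "z \<in> S - {x}"
        by blast
      then have "y \<in> orbit p z" using self[of y] eq by auto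
      then show "C = D" using eqI[of y z] yz by simp
    qed
    moreover have "orbit (bypass x p) ` (S - {x}) = (\<lambda>C. C - {x}) ` (orbit p ` (S - {x}))"
      unfolding image_image by (intro image_cong shrink) auto
    ultimately have "card (orbit (bypass x p) ` (S - {x})) = card (orbit p ` (S - {x}))"
      by (simp add: card_image)
    with False im' show ?thesis by (simp add: cycle_count_def)
  qed
qed

lemma bij_betw_bypass_list:
  assumes "bij_betw p S S" "finite S" "distinct xs" "set xs \<subseteq> S"
  shows "bij_betw (fold bypass xs p) (S - set xs) (S - set xs)"
  using assms
proof (induction xs arbitrary: p S)
  case (Cons x xs)
  have "bij_betw (fold bypass xs (bypass x p)) (S - {x} - set xs) (S - {x} - set xs)"
    using Cons.prems by (intro Cons.IH bij_betw_bypass) auto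
  then show ?case by (simp add: Diff_insert2[of S x "set xs"])
qed simp

lemma cycle_count_bypass_list:
  assumes "bij_betw p S S" "finite S" "distinct xs" "set xs \<subseteq> S"
  shows "cycle_count p S = closed_loops xs p + cycle_count (fold bypass xs p) (S - set xs)"
  using assms
proof (induction xs arbitrary: p S)
  case (Cons x xs)
  have "cycle_count (bypass x p) (S - {x}) = closed_loops xs (bypass x p)
      + cycle_count (fold bypass xs (bypass x p)) (S - {x} - set xs)"
    using Cons.prems by (intro Cons.IH bij_betw_bypass) auto
  then show ?case using Cons.prems cycle_count_bypass[of p S x] by (simp add: Diff_insert2[of S x "set xs"])
qed simp

lemma bypass_list_other: "p y \<notin> set xs \<Longrightarrow> fold bypass xs p y = p y"
  by (induction xs arbitrary: p) (auto simp: bypass_def)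

section \<open>Rotation systems of trivalent graphs\<close>

text \<open>
  The two cyclic permutations of a triple; \<open>b = False\<close> is \<open>d1 \<mapsto> d2 \<mapsto> d3 \<mapsto> d1\<close>.
\<close>

definition turns :: "('a \<Rightarrow> 'a) \<Rightarrow> 'a \<Rightarrow> 'a \<Rightarrow> 'a \<Rightarrow> bool \<Rightarrow> bool" where
  "turns f d1 d2 d3 b \<longleftrightarrow>
     (if b then f d1 = d3 \<and> f d3 = d2 \<and> f d2 = d1 else f d1 = d2 \<and> f d2 = d3 \<and> f d3 = d1)"

lemma orbit_subset_invariant:
  assumes "f d \<in> T" "f ` T \<subseteq> T"
  shows "orbit f d \<subseteq> T"
proof
  fix w assume "w \<in> orbit f d"
  then show "w \<in> T" by induction (use assms in auto)
qed

lemma cyclic_on_triple_iff: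
  assumes "distinct [d1, d2, d3]"
  shows "cyclic_on f {d1, d2, d3} \<longleftrightarrow> (\<exists>b. turns f d1 d2 d3 b)"
proof
  assume cyc: "cyclic_on f {d1, d2, d3}"
  have c3: "card {d1, d2, d3} = 3" using assms by simp
  have ne: "f d \<in> {d1, d2, d3} \<and> f d \<noteq> d" if "d \<in> {d1, d2, d3}" for d
    using eq_on_cyclic_on_iff1[OF cyc that] c3 by (metis numeral_eq_one_iff semiring_norm(86))
  have whole: "orbit f d = {d1, d2, d3}" if "d \<in> {d1, d2, d3}" for d
    using orbit_cyclic_eq3[OF cyc that] .
  have no2: "\<not> (f d = e \<and> f e = d)" if "d \<in> {d1, d2, d3}" for d e
  proof
    assume "f d = e \<and> f e = d"
    then have "orbit f d \<subseteq> {d, e}" by (intro orbit_subset_invariant) auto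
    then have "card {d1, d2, d3} \<le> card {d, e}"
      unfolding whole[OF that] by (intro card_mono) auto
    also have "\<dots> \<le> 2" by (simp add: card_insert_le_m1)
    finally show False using c3 by simp
  qed
  show "\<exists>b. turns f d1 d2 d3 b"
    using ne[of d1] ne[of d2] ne[of d3] no2[of d1 d2] no2[of d1 d3] no2[of d2 d3] assms
    by (auto simp: turns_def)
next
  assume "\<exists>b. turns f d1 d2 d3 b"
  then obtain b where b: "turns f d1 d2 d3 b" ..
  then have "orbit f d1 \<subseteq> {d1, d2, d3}"
    by (intro orbit_subset_invariant) (auto simp: turns_def split: if_splits)
  moreover have "{d1, d2, d3} \<subseteq> orbit f d1"
    using b orbit.base[of f d1] orbit.step[of "f d1" f d1] orbit.step[of "f (f d1)" f d1]
    by (auto simp: turns_def split: if_splits)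
  ultimately show "cyclic_on f {d1, d2, d3}" by (auto simp: cyclic_on_def)
qed

lemma turns_unique:
  "turns f d1 d2 d3 b \<Longrightarrow> turns f d1 d2 d3 b' \<Longrightarrow> distinct [d1, d2, d3] \<Longrightarrow> b = b'"
  by (auto simp: turns_def split: if_splits)

text \<open>
  The functions \<open>c1\<close>, \<open>c2\<close>, \<open>c3\<close> fix at every vertex a reference order of its three edge-ends, so that a
  cyclic ordering there becomes a bit.
\<close>

locale trivalent =
  fixes G :: "('a, 'b) pre_digraph" and c1 c2 c3 :: "'a \<Rightarrow> 'b \<times> bool"
  assumes ends_in_verts: "d \<in> edge_ends G \<Longrightarrow> end_vertex G d \<in> verts G"
    and ends_at: "v \<in> verts G \<Longrightarrow> ends_at G v = {c1 v, c2 v, c3 v}"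
    and distinct_ends: "v \<in> verts G \<Longrightarrow> distinct [c1 v, c2 v, c3 v]"
begin

lemma rotation_system_turns:
  assumes "rotation_system G \<rho>" "v \<in> verts G"
  shows "\<exists>b. turns \<rho> (c1 v) (c2 v) (c3 v) b"
  using assms cyclic_on_triple_iff[OF distinct_ends] ends_at by (auto simp: rotation_system_def)

lemma rotation_system_eqI:
  assumes "rotation_system G \<rho>" "rotation_system G \<rho>'"
    and "\<And>v. v \<in> verts G \<Longrightarrow> turns \<rho> (c1 v) (c2 v) (c3 v) (\<beta> v)"
    and "\<And>v. v \<in> verts G \<Longrightarrow> turns \<rho>' (c1 v) (c2 v) (c3 v) (\<beta> v)"
  shows "\<rho> = \<rho>'"
proof
  fix d
  show "\<rho> d = \<rho>' d"
  proof (cases "d \<in> edge_ends G")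
    case True
    define v where "v = end_vertex G d"
    have v: "v \<in> verts G" using ends_in_verts True by (simp add: v_def)
    have "d \<in> ends_at G v" using True by (simp add: ends_at_def v_def)
    then show ?thesis
      using assms(3,4)[OF v] by (auto simp: turns_def ends_at[OF v] split: if_splits)
  next
    case False
    then show ?thesis using assms(1,2) by (metis rotation_system_def permutes_not_in)
  qed
qed

text \<open>
  Together with \<open>rotation_system_eqI\<close>: rotation systems correspond to arbitrary assignments of bits to
  the vertices.
\<close>

lemma rotation_system_exists:
  assumes fin: "finite (edge_ends G)"
  shows "\<exists>\<rho>. rotation_system G \<rho> \<and> (\<forall>v \<in> verts G. turns \<rho> (c1 v) (c2 v) (c3 v) (\<beta> v))"
proof -
  define \<sigma> where "\<sigma> v = (if \<beta> v then id(c1 v := c3 v, c3 v := c2 v, c2 v := c1 v)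
    else id(c1 v := c2 v, c2 v := c3 v, c3 v := c1 v))" for v
  define \<rho> where "\<rho> d = (if d \<in> edge_ends G then \<sigma> (end_vertex G d) d else d)" for d
  have ends: "d \<in> ends_at G v \<longleftrightarrow> d \<in> edge_ends G \<and> end_vertex G d = v" for d v
    by (simp add: ends_at_def)
  have \<rho>\<sigma>: "\<rho> d = \<sigma> v d" if "d \<in> ends_at G v" for d v
    using that by (simp add: \<rho>_def ends)
  have turns: "turns \<rho> (c1 v) (c2 v) (c3 v) (\<beta> v)" if "v \<in> verts G" for v
  proof -
    have "\<rho> (c1 v) = \<sigma> v (c1 v)" "\<rho> (c2 v) = \<sigma> v (c2 v)" "\<rho> (c3 v) = \<sigma> v (c3 v)"
      by (rule \<rho>\<sigma>, simp add: ends_at[OF that])+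
    moreover have "c1 v \<noteq> c2 v" "c2 v \<noteq> c3 v" "c3 v \<noteq> c1 v"
      using distinct_ends[OF that] by auto
    ultimately show ?thesis
      by (cases "\<beta> v") (simp_all add: turns_def \<sigma>_def)
  qed
  have cyc: "cyclic_on \<rho> (ends_at G v)" if "v \<in> verts G" for v
    unfolding ends_at[OF that] cyclic_on_triple_iff[OF distinct_ends[OF that]]
    using turns[OF that] ..
  have "\<rho> ` edge_ends G \<subseteq> edge_ends G"
  proof (rule image_subsetI)
    fix d assume d: "d \<in> edge_ends G"
    let ?v = "end_vertex G d"
    have v: "?v \<in> verts G" using ends_in_verts[OF d] .
    have "d \<in> ends_at G ?v" using d by (simp add: ends)
    then have "\<rho> d \<in> ends_at G ?v"
      using turns[OF v] unfolding ends_at[OF v] by (auto simp: turns_def split: if_splits)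
    then show "\<rho> d \<in> edge_ends G" by (simp add: ends)
  qed
  moreover have "edge_ends G \<subseteq> \<rho> ` edge_ends G"
  proof
    fix d assume d: "d \<in> edge_ends G"
    let ?v = "end_vertex G d"
    have v: "?v \<in> verts G" using ends_in_verts[OF d] .
    have "d \<in> ends_at G ?v" using d by (simp add: ends)
    then have "d \<in> {c1 ?v, c2 ?v, c3 ?v}" unfolding ends_at[OF v] .
    then have "d \<in> \<rho> ` {c1 ?v, c2 ?v, c3 ?v}"
      using turns[OF v] by (auto simp: turns_def split: if_splits)
    then show "d \<in> \<rho> ` edge_ends G" unfolding ends_at[OF v, symmetric] by (auto simp: ends)
  qed
  ultimately have "\<rho> permutes edge_ends G"
    using fin by (intro bij_imp_permutes) (simp_all add: bij_betw_def eq_card_imp_inj_on, simp add: \<rho>_def)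
  with cyc turns show ?thesis by (auto simp: rotation_system_def)
qed

end

section \<open>The face permutation of a ladder, cut between two rungs\<close>

datatype strand = Upper | Lower | Handle

lemma UNIV_strand: "(UNIV :: strand set) = {Upper, Lower, Handle}"
  using strand.exhaust by auto

lemma all_strand: "(\<forall>s. P s) \<longleftrightarrow> P Upper \<and> P Lower \<and> P Handle"
  using strand.exhaust by metis

lemma bij_strand_cases:
  assumes "bij (\<pi> :: strand \<Rightarrow> strand)"
  shows "(\<pi> Upper, \<pi> Lower, \<pi> Handle) \<in> {(Upper, Lower, Handle), (Lower, Upper, Handle),
    (Handle, Lower, Upper), (Upper, Handle, Lower), (Lower, Handle, Upper), (Handle, Upper, Lower)}"
proof -
  have ne: "\<pi> Upper \<noteq> \<pi> Lower" "\<pi> Lower \<noteq> \<pi> Handle" "\<pi> Upper \<noteq> \<pi> Handle"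
    using assms by (auto simp: bij_def inj_eq)
  show ?thesis
    using ne by (cases "\<pi> Upper"; cases "\<pi> Lower"; cases "\<pi> Handle") simp_all
qed

text \<open>
  The facial walks at a root: coming in along strand \<open>s\<close>, a walk goes on along the successor of \<open>s\<close> in
  the cyclic order of the three strands there.
\<close>

fun spin :: "bool \<Rightarrow> strand \<Rightarrow> strand" where
  "spin b Upper = (if b then Handle else Lower)"
| "spin b Lower = (if b then Upper else Handle)"
| "spin b Handle = (if b then Lower else Upper)"

text \<open>
  Name each facial walk through the part left of the cut by the strand along which it leaves. Putting
  the top vertex of the next rung on the upper rail creates two corners: one on the walk that leaves
  along \<open>Upper\<close>, the other on the walk that enters along \<open>Upper\<close> and hence leaves along \<open>\<pi> Upper\<close>. The
  bit at the vertex says which of the two receives the rung.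
\<close>

definition upper_corner :: "(strand \<Rightarrow> strand) \<Rightarrow> bool \<Rightarrow> strand" where
  "upper_corner \<pi> t = (if t then Upper else \<pi> Upper)"

definition lower_corner :: "(strand \<Rightarrow> strand) \<Rightarrow> bool \<Rightarrow> strand" where
  "lower_corner \<pi> t = (if t then Lower else \<pi> Lower)"

text \<open>
  The number of faces that are still to be closed when the left part has the permutation \<open>\<pi>\<close>, the
  remaining rungs have the bits \<open>cs\<close>, and the right root has the bit \<open>y\<close>.
\<close>

primrec face_number :: "(strand \<Rightarrow> strand) \<Rightarrow> (bool \<times> bool) list \<Rightarrow> bool \<Rightarrow> nat" where
  "face_number \<pi> [] y = cycle_count (spin y \<circ> \<pi>) UNIV"
| "face_number \<pi> (c # cs) y =
     (let X = upper_corner \<pi> (fst c); Y = lower_corner \<pi> (snd c) in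
      (if X = Y then 1 else 0) + face_number (transpose X Y \<circ> \<pi>) cs y)"

type_synonym ladder_end = "ladder_edge option \<times> bool"

text \<open>
  The edge on which strand \<open>s\<close> crosses the cut before rung \<open>j + 1\<close>. Every cut is crossed by the same
  handle.
\<close>

fun strand_edge :: "nat \<Rightarrow> strand \<Rightarrow> ladder_edge option" where
  "strand_edge j Upper = Some (Inr (0, j))"
| "strand_edge j Lower = Some (Inr (1, j))"
| "strand_edge j Handle = None"

text \<open>
  The top vertex of rung \<open>j + 1\<close> is met at the tail of the rung, the bottom vertex at its head.
\<close>

definition rung_rotation :: "(ladder_end \<Rightarrow> ladder_end) \<Rightarrow> nat \<Rightarrow> bool \<times> bool \<Rightarrow> bool" where
  "rung_rotation \<rho> j c \<longleftrightarrow>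
     turns \<rho> (strand_edge j Upper, True) (strand_edge (Suc j) Upper, False)
       (Some (rung (Suc j)), False) (fst c) \<and>
     turns \<rho> (strand_edge j Lower, True) (strand_edge (Suc j) Lower, False)
       (Some (rung (Suc j)), True) (snd c)"

definition root_rotation :: "(ladder_end \<Rightarrow> ladder_end) \<Rightarrow> nat \<Rightarrow> bool \<Rightarrow> bool \<Rightarrow> bool" where
  "root_rotation \<rho> j b y \<longleftrightarrow>
     turns \<rho> (strand_edge j Upper, b) (strand_edge j Lower, b) (strand_edge j Handle, b) y"

primrec tail_rotation :: "(ladder_end \<Rightarrow> ladder_end) \<Rightarrow> nat \<Rightarrow> (bool \<times> bool) list \<Rightarrow> bool \<Rightarrow> bool" where
  "tail_rotation \<rho> j [] y = root_rotation \<rho> j True y"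
| "tail_rotation \<rho> j (c # cs) y = (rung_rotation \<rho> j c \<and> tail_rotation \<rho> (Suc j) cs y)"

text \<open>
  The edge-ends that remain when everything strictly left of cut \<open>j\<close> has been removed; both ends of the
  edges that cross the cut are kept.
\<close>

definition ends_from :: "nat \<Rightarrow> nat \<Rightarrow> ladder_end set" where
  "ends_from j n = ((\<lambda>(i, s). strand_edge i s) ` ({j..n} \<times> UNIV) \<union> (Some \<circ> rung) ` {j<..n}) \<times> UNIV"

lemma strand_edge_eq_iff:
  "strand_edge i s = strand_edge j s' \<longleftrightarrow> s = s' \<and> (i = j \<or> s = Handle)"
  by (cases s; cases s') auto

lemma strand_edge_not_rung [simp]: "strand_edge i s \<noteq> Some (rung j)" "Some (rung j) \<noteq> strand_edge i s"
  by (cases s; simp add: rung_def)+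

lemma rung_eq_iff [simp]: "rung i = rung j \<longleftrightarrow> i = j"
  by (simp add: rung_def)

lemma finite_ends_from: "finite (ends_from j n)"
  by (simp add: ends_from_def UNIV_strand)

lemma strand_end_mem: "(strand_edge i s, b) \<in> ends_from j n \<longleftrightarrow> j \<le> i \<and> i \<le> n \<or> s = Handle \<and> j \<le> n"
  by (auto simp: ends_from_def image_iff strand_edge_eq_iff)

lemma rung_end_mem: "(Some (rung i), b) \<in> ends_from j n \<longleftrightarrow> j < i \<and> i \<le> n"
  by (auto simp: ends_from_def image_iff)

lemma ends_from_mono: "j \<le> j' \<Longrightarrow> ends_from j' n \<subseteq> ends_from j n"
  by (fastforce simp: ends_from_def)

text \<open>
  The edge-ends that disappear when the cut moves across rung \<open>j + 1\<close>.
\<close>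

definition passed_ends :: "nat \<Rightarrow> ladder_end list" where
  "passed_ends j = [(strand_edge j Upper, True), (strand_edge j Upper, False),
     (strand_edge j Lower, True), (strand_edge j Lower, False),
     (Some (rung (Suc j)), True), (Some (rung (Suc j)), False)]"

lemma ends_from_Suc:
  assumes "j < n"
  shows "ends_from (Suc j) n = ends_from j n - set (passed_ends j)"
    and "set (passed_ends j) \<subseteq> ends_from j n" and "distinct (passed_ends j)"
proof -
  have mem: "d \<in> ends_from (Suc j) n \<longleftrightarrow> d \<in> ends_from j n \<and> d \<notin> set (passed_ends j)" for d
  proof (cases "\<exists>i. fst d = Some (rung i)")
    case True
    then obtain i b where "d = (Some (rung i), b)" by (cases d) auto
    then show ?thesis using assms
      by (cases b) (auto simp: rung_end_mem passed_ends_def simp del: strand_edge.simps)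
  next
    case False
    show ?thesis
    proof (cases "\<exists>i s. fst d = strand_edge i s")
      case True
      then obtain i s b where "d = (strand_edge i s, b)" by (cases d) auto
      then show ?thesis using assms
        by (cases b; cases s)
        (auto simp: strand_end_mem passed_ends_def strand_edge_eq_iff simp del: strand_edge.simps)
    next
      case none: False
      then have "d \<notin> ends_from j' n" for j'
        using False by (fastforce simp: ends_from_def)
      then show ?thesis by simp
    qed
  qed
  then show "ends_from (Suc j) n = ends_from j n - set (passed_ends j)" by blast
  show "set (passed_ends j) \<subseteq> ends_from j n" using assms
    unfolding passed_ends_def by (simp add: strand_end_mem rung_end_mem del: strand_edge.simps)
  show "distinct (passed_ends j)" by (simp add: passed_ends_def rung_def)
qed

text \<open>
  As a rewrite rule this evaluates \<open>p y\<close> only once, which keeps the evaluation of nested bypasses linear.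
\<close>

lemma bypass_apply: "p y = z \<Longrightarrow> bypass x p y = (if z = x then p x else z)"
  by (simp add: bypass_def)

text \<open>
  The effect of one rung. An end \<open>(strand_edge j s, True)\<close> leads a facial walk into the left part, which
  it leaves along \<open>(strand_edge j (\<pi> s), False)\<close>. There are six permutations \<open>\<pi>\<close> and four choices of bits
  at the two vertices of the rung, and in each of these cases the facial walks through the rung can be
  traced explicitly.
\<close>

lemma bypass_passed_ends:
  assumes "bij \<pi>" and strands: "\<And>s. p (strand_edge j s, True) = (strand_edge j (\<pi> s), False)"
    and rot: "rung_rotation (p \<circ> opposite_end) j c"
  defines "X \<equiv> upper_corner \<pi> (fst c)" and "Y \<equiv> lower_corner \<pi> (snd c)"
  shows "closed_loops (passed_ends j) p = (if X = Y then 1 else 0)"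
    and "fold bypass (passed_ends j) p (strand_edge (Suc j) s, True)
      = (strand_edge (Suc j) ((transpose X Y \<circ> \<pi>) s), False)"
proof -
  obtain b b' where c: "c = (b, b')" by (cases c)
  have "closed_loops (passed_ends j) p = (if X = Y then 1 else 0) \<and>
    (\<forall>s. fold bypass (passed_ends j) p (strand_edge (Suc j) s, True)
      = (strand_edge (Suc j) ((transpose X Y \<circ> \<pi>) s), False))"
    using strands[of Upper] strands[of Lower] strands[of Handle] rot bij_strand_cases[OF assms(1)]
    unfolding all_strand
    by (cases b; cases b'; simp add: c X_def Y_def upper_corner_def lower_corner_def rung_rotation_def
        turns_def passed_ends_def rung_def; elim disjE;
        simp add: bypass_apply transpose_def)
  then show "closed_loops (passed_ends j) p = (if X = Y then 1 else 0)"
    and "fold bypass (passed_ends j) p (strand_edge (Suc j) s, True)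
      = (strand_edge (Suc j) ((transpose X Y \<circ> \<pi>) s), False)" by auto
qed

text \<open>
  Moving the cut does not affect the facial walks further to the right.
\<close>

lemma tail_rotation_cong:
  assumes "tail_rotation (p \<circ> opposite_end) j cs y"
    and "\<And>d. p d \<in> ends_from j (j + length cs) \<Longrightarrow> p' d = p d"
  shows "tail_rotation (p' \<circ> opposite_end) j cs y"
  using assms
proof (induction cs arbitrary: j)
  case Nil
  have mem: "(strand_edge j s, b) \<in> ends_from j j" for s b
    by (simp add: strand_end_mem)
  show ?case
    using Nil mem
    by (auto simp: root_rotation_def turns_def simp del: strand_edge.simps split: if_splits)
next
  case (Cons c cs)
  let ?n = "j + length (c # cs)"
  have mem: "(strand_edge j s, b) \<in> ends_from j ?n"
    "(strand_edge (Suc j) s, b) \<in> ends_from j ?n"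
    for s b
    by (simp_all add: strand_end_mem del: strand_edge.simps)
  have mem': "(Some (rung (Suc j)), b) \<in> ends_from j ?n" for b
    by (simp add: rung_end_mem)
  have "rung_rotation (p' \<circ> opposite_end) j c"
    using Cons.prems(1) Cons.prems(2) mem mem'
    by (auto simp: rung_rotation_def turns_def simp del: strand_edge.simps split: if_splits)
  moreover have "tail_rotation (p' \<circ> opposite_end) (Suc j) cs y"
  proof (rule Cons.IH)
    fix d assume "p d \<in> ends_from (Suc j) (Suc j + length cs)"
    then have "p d \<in> ends_from j ?n"
      using ends_from_mono[of j "Suc j" ?n] by auto
    then show "p' d = p d" by (rule Cons.prems)
  qed (use Cons.prems in simp)
  ultimately show ?case unfolding tail_rotation.simps ..
qed

lemma orbit_image_conj:
  assumes "\<And>s. p (f s) = f (q s)"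
  shows "orbit p (f s) = f ` orbit q s"
proof -
  have "(p ^^ k) (f s) = f ((q ^^ k) s)" for k
    by (induction k) (simp_all add: assms)
  then show ?thesis by (auto simp: orbit_altdef)
qed

lemma cycle_count_conj:
  assumes "\<And>s. p (f s) = f (q s)" "inj f"
  shows "cycle_count p (f ` S) = cycle_count q S"
proof -
  have "orbit p ` f ` S = (`) f ` orbit q ` S"
    by (simp add: image_image orbit_image_conj[of p f q, OF assms(1)])
  moreover have "inj_on ((`) f) A" for A
    using assms(2) by (simp add: inj_on_def inj_image_eq_iff)
  ultimately show ?thesis by (simp add: cycle_count_def card_image)
qed

text \<open>
  The cut is moved to the right, rung by rung, with \<open>p\<close> as the face permutation of what remains. In the
  end only the three strands are left, and the right root closes them up by \<open>spin y\<close>.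
\<close>

lemma cycle_count_ends_from:
  assumes "bij \<pi>" "bij_betw p (ends_from j n) (ends_from j n)" "n = j + length cs"
    and "\<And>s. p (strand_edge j s, True) = (strand_edge j (\<pi> s), False)"
    and "tail_rotation (p \<circ> opposite_end) j cs y"
  shows "cycle_count p (ends_from j n) = face_number \<pi> cs y"
  using assms
proof (induction cs arbitrary: j \<pi> p)
  case Nil
  let ?out = "[(strand_edge j Upper, False), (strand_edge j Lower, False), (strand_edge j Handle, False)]"
  let ?in = "\<lambda>s. (strand_edge j s, True)"
  have spin: "p (strand_edge j s, False) = (strand_edge j (spin y s), True)" for s
    using Nil.prems(5) by (cases s) (auto simp: root_rotation_def turns_def split: if_splits)
  have ends: "ends_from j n = range ?in \<union> set ?out"
    using Nil.prems(3) by (auto simp: ends_from_def UNIV_strand UNIV_bool)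
  have out: "range ?in = ends_from j n - set ?out"
    unfolding ends by auto
  have p: "fold bypass ?out p (?in s) = ?in ((spin y \<circ> \<pi>) s)" for s
    using Nil.prems(4)[of s] spin[of "\<pi> s"]
    by (cases "\<pi> s"; cases "spin y (\<pi> s)") (simp_all add: bypass_def)
  have "distinct ?out" by simp
  moreover have "set ?out \<subseteq> ends_from j n" unfolding ends by (rule Un_upper2)
  ultimately have "cycle_count p (ends_from j n)
      = closed_loops ?out p + cycle_count (fold bypass ?out p) (range ?in)"
    unfolding out by (rule cycle_count_bypass_list[OF Nil.prems(2) finite_ends_from])
  also have "closed_loops ?out p = 0"
    using spin[of Upper] spin[of Lower] spin[of Handle]
    by (simp add: bypass_def)
  also have "cycle_count (fold bypass ?out p) (range ?in) = cycle_count (spin y \<circ> \<pi>) UNIV"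
    by (rule cycle_count_conj[where f = ?in], rule p) (simp add: inj_def strand_edge_eq_iff)
  finally show ?case by simp
next
  case (Cons c cs)
  let ?X = "upper_corner \<pi> (fst c)" and ?Y = "lower_corner \<pi> (snd c)"
  let ?p = "fold bypass (passed_ends j) p"
  have jn: "j < n" using Cons.prems(3) by simp
  have rot: "rung_rotation (p \<circ> opposite_end) j c"
    using Cons.prems(5) unfolding tail_rotation.simps ..
  have "cycle_count p (ends_from j n)
      = closed_loops (passed_ends j) p + cycle_count ?p (ends_from (Suc j) n)"
    unfolding ends_from_Suc(1)[OF jn] using Cons.prems(2) ends_from_Suc(2,3)[OF jn]
    by (intro cycle_count_bypass_list finite_ends_from)
  also have "closed_loops (passed_ends j) p = (if ?X = ?Y then 1 else 0)"
    using Cons.prems(1,4) rot by (rule bypass_passed_ends(1))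
  also have "cycle_count ?p (ends_from (Suc j) n) = face_number (transpose ?X ?Y \<circ> \<pi>) cs y"
  proof (rule Cons.IH)
    show "bij (transpose ?X ?Y \<circ> \<pi>)" using Cons.prems(1) by (intro bij_comp) simp_all
    show "bij_betw ?p (ends_from (Suc j) n) (ends_from (Suc j) n)"
      unfolding ends_from_Suc(1)[OF jn] using Cons.prems(2) ends_from_Suc(2,3)[OF jn]
      by (intro bij_betw_bypass_list finite_ends_from)
    show "n = Suc j + length cs" using Cons.prems(3) by simp
    show "?p (strand_edge (Suc j) s, True) = (strand_edge (Suc j) ((transpose ?X ?Y \<circ> \<pi>) s), False)" for s
      using Cons.prems(1,4) rot by (rule bypass_passed_ends(2))
    show "tail_rotation (?p \<circ> opposite_end) (Suc j) cs y"
    proof (rule tail_rotation_cong)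
      show "tail_rotation (p \<circ> opposite_end) (Suc j) cs y"
        using Cons.prems(5) unfolding tail_rotation.simps ..
      fix d assume "p d \<in> ends_from (Suc j) (Suc j + length cs)"
      then have "p d \<notin> set (passed_ends j)"
        using ends_from_Suc(1)[OF jn] Cons.prems(3) by auto
      then show "?p d = p d" by (rule bypass_list_other)
    qed
  qed
  finally show ?case by (simp add: Let_def)
qed

section \<open>Counting orientations by their number of faces\<close>

lemma cycle_count_strand:
  assumes "bij (\<pi> :: strand \<Rightarrow> strand)"
  shows "cycle_count \<pi> UNIV = closed_loops [Upper, Lower, Handle] \<pi>"
proof -
  let ?l = "[Upper, Lower, Handle]"
  have "cycle_count \<pi> UNIV = closed_loops ?l \<pi> + cycle_count (fold bypass ?l \<pi>) (UNIV - set ?l)"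
    using assms by (intro cycle_count_bypass_list) (simp_all add: UNIV_strand)
  also have "UNIV - set ?l = {}" by (simp add: UNIV_strand)
  finally show ?thesis by (simp only: cycle_count_def image_empty card.empty add_0_right)
qed

lemma bij_spin: "bij (spin b)"
  by (rule o_bij[of "spin (\<not> b)"]) (auto simp: fun_eq_iff all_strand)

lemma finite_codes: "finite {(cs :: (bool \<times> bool) list, y :: bool). length cs = n \<and> P cs y}"
proof (rule finite_subset)
  show "{(cs, y). length cs = n \<and> P cs y} \<subseteq> {cs. set cs \<subseteq> UNIV \<and> length cs = n} \<times> UNIV" by auto
  show "finite ({cs :: (bool \<times> bool) list. set cs \<subseteq> UNIV \<and> length cs = n} \<times> (UNIV :: bool set))"
    by (intro finite_cartesian_product finite_lists_length_eq) auto
qed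

lemma card_codes_Suc:
  "card {(cs :: (bool \<times> bool) list, y :: bool). length cs = Suc n \<and> P cs y}
    = (\<Sum>c \<in> UNIV. card {(cs, y). length cs = n \<and> P (c # cs) y})"
proof -
  let ?S = "\<lambda>c. {(cs, y). length cs = n \<and> P (c # cs) y}"
  let ?f = "\<lambda>c (cs, y). (c # cs, y)"
  have "{(cs, y). length cs = Suc n \<and> P cs y} = (\<Union>c. ?f c ` ?S c)"
    by (auto simp: length_Suc_conv image_iff)
  also have "card \<dots> = (\<Sum>c \<in> UNIV. card (?f c ` ?S c))"
    by (rule card_UN_disjoint) (auto simp: finite_codes)
  also have "\<dots> = (\<Sum>c \<in> UNIV. card (?S c))"
    by (intro sum.cong card_image) (auto simp: inj_on_def)
  finally show ?thesis .
qed

text \<open>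
  The number of faces \<open>m\<close> is an integer because the recurrences refer to \<open>m - 1\<close>.
\<close>

definition face_count :: "(strand \<Rightarrow> strand) \<Rightarrow> nat \<Rightarrow> int \<Rightarrow> nat" where
  "face_count \<pi> n m = card {(cs, y). length cs = n \<and> int (face_number \<pi> cs y) = m}"

lemma sum_bool_pair: "(\<Sum>c \<in> (UNIV :: (bool \<times> bool) set). f c) =
    f (False, False) + f (False, True) + f (True, False) + f (True, True)"
proof -
  have U: "(UNIV :: (bool \<times> bool) set) = {(False, False), (False, True), (True, False), (True, True)}"
    by auto
  show ?thesis unfolding U by (simp add: add_ac)
qed

lemma face_count_Suc:
  "face_count \<pi> (Suc n) m = (\<Sum>c \<in> UNIV.
     let X = upper_corner \<pi> (fst c); Y = lower_corner \<pi> (snd c)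
     in face_count (transpose X Y \<circ> \<pi>) n (m - (if X = Y then 1 else 0)))"
proof -
  have eq: "int ((if P then 1 else 0) + f) = m \<longleftrightarrow> int f = m - (if P then 1 else 0)" for P f
    by auto
  show ?thesis
    unfolding face_count_def card_codes_Suc face_number.simps Let_def eq ..
qed

lemma face_count_0:
  assumes "bij \<pi>"
  shows "face_count \<pi> 0 m = (\<Sum>y \<in> UNIV. if int (closed_loops [Upper, Lower, Handle] (spin y \<circ> \<pi>)) = m then 1 else 0)"
proof -
  have eq: "cycle_count (spin y \<circ> \<pi>) UNIV = closed_loops [Upper, Lower, Handle] (spin y \<circ> \<pi>)" for y
    using assms by (intro cycle_count_strand bij_comp bij_spin)
  let ?P = "\<lambda>y. int (closed_loops [Upper, Lower, Handle] (spin y \<circ> \<pi>)) = m"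
  have "{(cs :: (bool \<times> bool) list, y). length cs = 0 \<and> int (face_number \<pi> cs y) = m} = {[]} \<times> {y. ?P y}"
    using eq by auto
  then have "face_count \<pi> 0 m = card {y. ?P y}"
    unfolding face_count_def by (simp only: card_cartesian_product_singleton)
  then show ?thesis by (simp add: sum.If_cases Int_def)
qed

text \<open>
  Up to the reflection that exchanges the rails, the six permutations fall into four classes: the
  identity, the exchange of the rails, the two transpositions that move the handle, and the two
  3-cycles. The identity and the handle transpositions lead back to the other two classes in one step,
  which leaves recurrences of order two for \<open>swap_count\<close> and \<open>spin_count\<close>. A Ringel ladder starts from a
  3-cycle, at its left root.
\<close>

definition swap_count :: "nat \<Rightarrow> int \<Rightarrow> nat" where
  "swap_count n m = face_count (transpose Upper Lower) n m"

definition spin_count :: "nat \<Rightarrow> int \<Rightarrow> nat" where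
  "spin_count n m = face_count (spin False) n m + face_count (spin True) n m"

lemma face_count_id_Suc: "face_count id (Suc n) m = 4 * swap_count n m"
  by (simp add: face_count_Suc sum_bool_pair upper_corner_def lower_corner_def swap_count_def
      transpose_commute[of Lower Upper])

lemma swap_count_Suc:
  "swap_count (Suc n) m = 2 * face_count id n m + 2 * swap_count n (m - 1)"
  by (simp add: face_count_Suc sum_bool_pair upper_corner_def lower_corner_def swap_count_def
      transpose_commute[of Lower Upper])

lemma spin_comp:
  "transpose Lower Handle \<circ> spin False = transpose Upper Handle"
  "transpose Upper Lower \<circ> spin False = transpose Lower Handle"
  "transpose Upper Handle \<circ> spin False = transpose Upper Lower"
  "transpose Handle Upper \<circ> spin True = transpose Lower Handle"
  "transpose Upper Lower \<circ> spin True = transpose Upper Handle"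
  "transpose Handle Lower \<circ> spin True = transpose Upper Lower"
  by (auto simp: fun_eq_iff transpose_def all_strand)

lemma transpose_comp:
  "transpose Handle Lower \<circ> transpose Upper Handle = spin False"
  "transpose Upper Lower \<circ> transpose Upper Handle = spin True"
  "transpose Upper Lower \<circ> transpose Lower Handle = spin False"
  "transpose Upper Handle \<circ> transpose Lower Handle = spin True"
  by (auto simp: fun_eq_iff transpose_def all_strand)

lemma spin_count_Suc:
  "spin_count (Suc n) m = 2 * (face_count (transpose Upper Handle) n m
     + face_count (transpose Lower Handle) n m) + spin_count n (m - 1) + 2 * swap_count n m"
  by (simp add: face_count_Suc sum_bool_pair upper_corner_def lower_corner_def swap_count_def
      spin_count_def spin_comp)

lemma handle_count_Suc:
  "face_count (transpose Upper Handle) (Suc n) m = 2 * spin_count n m"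
  "face_count (transpose Lower Handle) (Suc n) m = 2 * spin_count n m"
  by (simp_all add: face_count_Suc sum_bool_pair upper_corner_def lower_corner_def
      spin_count_def transpose_comp)

lemma swap_count_Suc_Suc:
  "swap_count (Suc (Suc n)) m = 8 * swap_count n m + 2 * swap_count (Suc n) (m - 1)"
  by (simp add: swap_count_Suc[of "Suc n"] face_count_id_Suc)

lemma spin_count_Suc_Suc:
  "spin_count (Suc (Suc n)) m = 8 * spin_count n m + spin_count (Suc n) (m - 1) + 2 * swap_count (Suc n) m"
  by (simp add: spin_count_Suc[of "Suc n"] handle_count_Suc)

lemma swap_count_0: "swap_count 0 m = (if m = 2 then 2 else 0)"
  by (simp add: swap_count_def face_count_0 UNIV_bool bypass_def)

lemma face_count_id_0: "face_count id 0 m = (if m = 1 then 2 else 0)"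
  by (simp add: face_count_0 UNIV_bool bypass_def)

lemma handle_count_0:
  "face_count (transpose Upper Handle) 0 m = (if m = 2 then 2 else 0)"
  "face_count (transpose Lower Handle) 0 m = (if m = 2 then 2 else 0)"
  by (simp_all add: face_count_0 UNIV_bool bypass_def)

lemma spin_count_0: "spin_count 0 m = (if m = 1 then 2 else 0) + (if m = 3 then 2 else 0)"
  by (simp add: spin_count_def face_count_0 bij_spin UNIV_bool bypass_def)


section \<open>The ladder coefficients\<close>

text \<open>
  The generating polynomial of the \<open>ladder_coeff n k\<close> satisfies the Fibonacci-like recurrence
  \<open>P (n + 2) = P (n + 1) + y * P n\<close>, see \<open>ladder_coeff_Suc_Suc\<close>.
\<close>

definition ladder_coeff :: "nat \<Rightarrow> nat \<Rightarrow> nat" where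
  "ladder_coeff n k = ((n - k) choose k) + ((n + 1 - k) choose k)"

lemma ladder_coeff_0 [simp]: "ladder_coeff n 0 = 2" by (simp add: ladder_coeff_def)

lemma ladder_coeff_eq_0: "n + 1 < 2 * k \<Longrightarrow> ladder_coeff n k = 0"
  by (simp add: ladder_coeff_def binomial_eq_0)

lemma ladder_coeff_Suc_Suc:
  "ladder_coeff (Suc (Suc n)) (Suc k) = ladder_coeff (Suc n) (Suc k) + ladder_coeff n k"
proof (cases "k \<le> n")
  case True
  then have "Suc (Suc n) - Suc k = Suc (n - k)" "Suc (Suc n) + 1 - Suc k = Suc (n + 1 - k)"
    by auto
  then show ?thesis by (simp add: ladder_coeff_def del: diff_Suc_Suc)
next
  case False
  then show ?thesis by (cases "k = Suc n") (auto simp: ladder_coeff_def)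
qed

text \<open>
  With \<open>j = n + 1 - 2 k\<close>, both binomial coefficients are multiples of \<open>fact (n - k) / (fact k * fact j)\<close>,
  by \<open>j\<close> and by \<open>k + j\<close>, so that their sum is a single hypergeometric term.
\<close>

lemma ladder_coeff_fact:
  assumes "n + 1 = 2 * k + j"
  shows "real (ladder_coeff n k) * (fact k * fact j) = fact (n - k) * (real k + 2 * real j)"
proof -
  have kn: "k \<le> n" using assms by (cases k) auto
  have "real ((n - k) choose k) * (fact k * fact j) = fact (n - k) * real j"
  proof (cases j)
    case 0
    with assms show ?thesis by auto
  next
    case (Suc i)
    with assms have "n - k - k = i" "k \<le> n - k" by auto
    with Suc binomial_fact_lemma[of k "n - k", THEN arg_cong[of _ _ real]] show ?thesis
      by (simp add: algebra_simps)
  qed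
  moreover have "real ((n + 1 - k) choose k) * (fact k * fact j) = fact (n - k) * (real k + real j)"
  proof -
    have kj: "real k + real j = real (n + 1 - k)" using assms by simp
    have "n + 1 - k - k = j" "k \<le> n + 1 - k" "n + 1 - k = Suc (n - k)" using assms kn by auto
    with binomial_fact_lemma[of k "n + 1 - k", THEN arg_cong[of _ _ real]] show ?thesis
      unfolding kj by (simp add: mult_ac)
  qed
  ultimately show ?thesis by (simp add: ladder_coeff_def algebra_simps)
qed

text \<open>
  The quotient of consecutive coefficients in closed form; it is cleared of denominators because
  \<open>k + j - 1\<close> may vanish. All later estimates on the coefficients are obtained by multiplying instances
  of this equation.
\<close>

lemma ladder_coeff_ratio:
  assumes "n + 1 = 2 * k + j"
  shows "real (ladder_coeff n (Suc k)) * ((real k + 1) * (real k + real j - 1) * (real k + 2 * real j)) =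
    real (ladder_coeff n k) * (real j * (real j - 1) * (real k + 2 * real j - 3))"
proof (cases "j < 2")
  case True
  then have "j = 0 \<or> j = 1" by auto
  with ladder_coeff_eq_0[of n "Suc k"] assms show ?thesis by auto
next
  case False
  then obtain i where i: "j = Suc (Suc i)" by (metis add_2_eq_Suc le_Suc_ex not_less)
  have 1: "real (ladder_coeff n (Suc k)) * (fact (Suc k) * fact i) = fact (n - Suc k) * (real (Suc k) + 2 * real i)"
    using assms i by (intro ladder_coeff_fact) simp
  have 2: "real (ladder_coeff n k) * (fact k * fact j) = fact (n - k) * (real k + 2 * real j)"
    using assms by (rule ladder_coeff_fact)
  have nk: "n - k = Suc (n - Suc k)" using assms i by simp
  have f: "fact (n - k) = (real k + real j - 1) * (fact (n - Suc k) :: real)"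
    using assms i unfolding nk by (simp add: of_nat_diff algebra_simps)
  have j: "(fact j :: real) = real j * (real j - 1) * fact i" by (simp add: i algebra_simps)
  have "real (ladder_coeff n (Suc k)) * ((real k + 1) * (real k + real j - 1) * (real k + 2 * real j)) * (fact k * fact i)
    = (real (ladder_coeff n (Suc k)) * (fact (Suc k) * fact i)) * ((real k + real j - 1) * (real k + 2 * real j))"
    by (simp add: algebra_simps)
  also have "\<dots> = fact (n - k) * (real k + 2 * real j) * (real k + 2 * real j - 3)"
    unfolding 1 f by (simp add: i)
  also have "\<dots> = real (ladder_coeff n k) * (real j * (real j - 1) * (real k + 2 * real j - 3)) * (fact k * fact i)"
    unfolding 2[symmetric] j by simp
  finally show ?thesis by simp
qed

lemma ladder_coeff_pos: "2 * k \<le> n + 1 \<Longrightarrow> ladder_coeff n k > 0"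
proof -
  assume "2 * k \<le> n + 1"
  then have "0 < (n + 1 - k) choose k" by (intro zero_less_binomial) linarith
  then show ?thesis by (simp add: ladder_coeff_def)
qed

text \<open>
  Stronger than log-concavity by the factor \<open>(k + 1) / (k + 2)\<close>, which is already present in the
  quotients of consecutive terms of \<open>1 / fact k\<close>.
\<close>

lemma ladder_coeff_strict_log_concave:
  "real (k + 2) * (real (ladder_coeff n k) * real (ladder_coeff n (k + 2)))
    \<le> real (k + 1) * (real (ladder_coeff n (k + 1)))\<^sup>2"
proof (cases "2 * (k + 2) \<le> n + 1")
  case True
  then obtain j where j: "n + 1 = 2 * (k + 2) + j" by (metis le_Suc_ex)
  define d0 d1 d2 a b p where "d0 = real (ladder_coeff n k)" and "d1 = real (ladder_coeff n (k + 1))"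
    and "d2 = real (ladder_coeff n (k + 2))" and "a = real k" and "b = real j" and "p = a + 2 * b + 2"
  have nn: "a \<ge> 0" "b \<ge> 0" "p > 0" "d0 > 0" "d1 > 0" "d2 > 0"
    unfolding d0_def d1_def d2_def of_nat_0_less_iff
    using True by (auto simp: a_def b_def p_def intro!: ladder_coeff_pos)
  have r0: "d1 * ((a + 1) * (a + b + 3) * (p + 6)) = d0 * ((b + 4) * (b + 3) * (p + 3))"
    using ladder_coeff_ratio[OF j[THEN trans, of "2 * k + (j + 4)"]]
    by (simp add: d0_def d1_def a_def b_def p_def algebra_simps)
  have r1: "d2 * ((a + 2) * (a + b + 2) * (p + 3)) = d1 * ((b + 2) * (b + 1) * p)"
    using ladder_coeff_ratio[OF j[THEN trans, of "2 * (k + 1) + (j + 2)"]]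
    by (simp add: d1_def d2_def a_def b_def p_def algebra_simps)
  define X where "X = (a + b + 2) * (b + 4) * ((b + 3) * (p + 3)\<^sup>2)"
  define Y where "Y = (a + b + 3) * (b + 2) * ((b + 1) * (p * (p + 6)))"
  have X: "X > 0" using nn by (simp add: X_def)
  have "(a + b + 3) * (b + 2) \<le> (a + b + 2) * (b + 4)"
    using nn by (simp add: algebra_simps)
  moreover have "(b + 1) * (p * (p + 6)) \<le> (b + 3) * (p + 3)\<^sup>2"
    using nn by (intro mult_mono) (auto simp: algebra_simps power2_eq_square)
  ultimately have "Y \<le> X"
    unfolding X_def Y_def by (rule mult_mono) (use nn in auto)
  have "d0 * ((b + 4) * (b + 3) * (p + 3)) * (d2 * ((a + 2) * (a + b + 2) * (p + 3)))
      = d1 * ((a + 1) * (a + b + 3) * (p + 6)) * (d1 * ((b + 2) * (b + 1) * p))"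
    unfolding r0 r1 ..
  then have "((a + 2) * (d0 * d2)) * X = ((a + 1) * d1\<^sup>2) * Y"
    by (simp add: X_def Y_def power2_eq_square mult_ac)
  also have "\<dots> \<le> ((a + 1) * d1\<^sup>2) * X"
    using \<open>Y \<le> X\<close> nn by (intro mult_left_mono) auto
  finally have "(a + 2) * (d0 * d2) \<le> (a + 1) * d1\<^sup>2" using X by simp
  then show ?thesis by (simp add: d0_def d1_def d2_def a_def add_ac)
next
  case False
  then show ?thesis using ladder_coeff_eq_0[of n "k + 2"] by simp
qed

text \<open>
  Near the top of the support, that is for small \<open>j\<close>, the factor \<open>j * (j - 1)\<close> makes the outer product
  much smaller than the inner one.
\<close>

lemma ladder_coeff_cross:
  assumes "n + 1 = 2 * (k + 2) + j"
  shows "(real j + 4) * (real j + 3) * (real (ladder_coeff n k) * real (ladder_coeff n (k + 3)))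
    \<le> real j * (real j - 1) * (real (ladder_coeff n (k + 1)) * real (ladder_coeff n (k + 2)))"
proof -
  define d0 d1 d2 d3 a b p where "d0 = real (ladder_coeff n k)" and "d1 = real (ladder_coeff n (k + 1))"
    and "d2 = real (ladder_coeff n (k + 2))" and "d3 = real (ladder_coeff n (k + 3))"
    and "a = real k" and "b = real j" and "p = a + 2 * b + 2"
  note defs = d0_def d1_def d2_def d3_def a_def b_def p_def
  have nn: "a \<ge> 0" "b \<ge> 0" "p > 0" "d1 \<ge> 0" "d2 \<ge> 0"
    by (simp_all add: defs)
  have jj: "0 \<le> b * (b - 1)" by (cases j) (auto simp: b_def)
  have r0: "d1 * ((a + 1) * (a + b + 3) * (p + 6)) = d0 * ((b + 4) * (b + 3) * (p + 3))"
    using ladder_coeff_ratio[OF assms[THEN trans, of "2 * k + (j + 4)"]] by (simp add: defs algebra_simps)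
  have r2: "d3 * ((a + 3) * (a + b + 1) * p) = d2 * (b * (b - 1) * (p - 3))"
    using ladder_coeff_ratio[OF assms] by (simp add: defs algebra_simps numeral_3_eq_3)
  define X where "X = (a + 3) * (a + b + 1) * (p * (p + 3))"
  define Y where "Y = (a + 1) * (a + b + 3) * ((p - 3) * (p + 6))"
  have X: "X > 0" using nn by (simp add: X_def add_nonneg_pos)
  have "Y \<le> (a + 1) * (a + b + 3) * (p * (p + 3))"
    unfolding Y_def using nn by (intro mult_left_mono) (auto simp: algebra_simps)
  also have "\<dots> \<le> X"
    unfolding X_def using nn by (intro mult_right_mono) (auto simp: algebra_simps)
  finally have "Y \<le> X" .
  have "d0 * ((b + 4) * (b + 3) * (p + 3)) * (d3 * ((a + 3) * (a + b + 1) * p))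
      = d1 * ((a + 1) * (a + b + 3) * (p + 6)) * (d2 * (b * (b - 1) * (p - 3)))"
    unfolding r0 r2 ..
  then have "((b + 4) * (b + 3) * (d0 * d3)) * X = (b * (b - 1) * (d1 * d2)) * Y"
    by (simp add: X_def Y_def mult_ac)
  also have "\<dots> \<le> (b * (b - 1) * (d1 * d2)) * X"
    using nn by (intro mult_left_mono[OF \<open>Y \<le> X\<close>] mult_nonneg_nonneg[OF jj]) auto
  finally have "(b + 4) * (b + 3) * (d0 * d3) \<le> b * (b - 1) * (d1 * d2)" using X by simp
  then show ?thesis by (simp add: defs)
qed

lemma ladder_coeff_growth:
  assumes "n + 1 = 2 * (k + 1) + j"
  shows "real (k + 1) * real (ladder_coeff n (k + 1)) \<le> (real j + 2) * real (ladder_coeff n k)"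
proof -
  define d1 d2 a b p where "d1 = real (ladder_coeff n k)" and "d2 = real (ladder_coeff n (k + 1))"
    and "a = real k" and "b = real j" and "p = a + 2 * b + 1"
  note defs = d1_def d2_def a_def b_def p_def
  have nn: "a \<ge> 0" "b \<ge> 0" "p > 0" "d1 \<ge> 0" "d2 \<ge> 0"
    by (simp_all add: defs)
  have "d2 * ((a + 1) * (a + b + 1) * (p + 3)) = d1 * ((b + 2) * (b + 1) * p)"
    using ladder_coeff_ratio[OF assms[THEN trans, of "2 * k + (j + 2)"]] by (simp add: defs algebra_simps)
  then have "(a + 1) * d2 * ((a + b + 1) * (p + 3)) = (b + 2) * d1 * ((b + 1) * p)"
    by (simp add: mult_ac)
  also have "\<dots> \<le> (b + 2) * d1 * ((a + b + 1) * (p + 3))"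
    using nn by (intro mult_left_mono mult_mono) auto
  finally have "(a + 1) * d2 \<le> (b + 2) * d1"
    by (rule mult_right_le_imp_le) (use nn in simp)
  then show ?thesis by (simp add: defs add_ac)
qed


section \<open>Log-concavity of the closed form\<close>

text \<open>
  Log-concavity at one index of the sum of \<open>u = (q / 4 * d1, q * d2, 4 * q * d3)\<close> and
  \<open>w = ((N - q / 32) * d0, (N - q / 8) * d1, (N - q / 2) * d2)\<close>. The contribution of \<open>u\<close> alone is
  nonnegative. The factors of \<open>w\<close> that do not involve the \<open>d\<close> are strictly log-concave, with surplus
  \<open>9 / 32 * N * q\<close>. The mixed term is \<open>q * M\<close> below. The two alternatives in the hypothesis correspond to a
  nonnegative \<open>M\<close> and to an \<open>M\<close> that is bounded below by \<open>- 9 / 4 * N * d1 * d2\<close> and compensated by \<open>w\<close>.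
\<close>

lemma mixed_log_concave:
  fixes q N d0 d1 d2 d3 :: real
  assumes "0 \<le> q" "0 \<le> N" and lc: "d1 * d3 \<le> d2\<^sup>2" "0 \<le> d1" "0 \<le> d2"
    and *: "(4 * N - q / 8) * (d0 * d3) \<le> (7 / 4 * N - q / 8) * (d1 * d2)
        \<and> 0 \<le> (N - q / 32) * (N - q / 2) * (d1\<^sup>2 - d0 * d2)
      \<or> d0 * d3 \<le> d1 * d2 \<and> q \<le> 2 * N \<and>
        9 / 4 * q * N * (d1 * d2) \<le> (N - q / 32) * (N - q / 2) * (d1\<^sup>2 - d0 * d2)"
  shows "(q / 4 * d1 + (N - q / 32) * d0) * (4 * q * d3 + (N - q / 2) * d2)
    \<le> (q * d2 + (N - q / 8) * d1)\<^sup>2"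
proof -
  define W where "W = (N - q / 32) * (N - q / 2) * (d1\<^sup>2 - d0 * d2)"
  define M where "M = (7 / 4 * N - q / 8) * (d1 * d2) - (4 * N - q / 8) * (d0 * d3)"
  have "(q * d2 + (N - q / 8) * d1)\<^sup>2 - (q / 4 * d1 + (N - q / 32) * d0) * (4 * q * d3 + (N - q / 2) * d2)
     = q\<^sup>2 * (d2\<^sup>2 - d1 * d3) + 9 / 32 * N * q * d1\<^sup>2 + (W + q * M)"
    unfolding W_def M_def by (simp add: field_simps power2_eq_square)
  moreover have "0 \<le> q\<^sup>2 * (d2\<^sup>2 - d1 * d3)" "0 \<le> 9 / 32 * N * q * d1\<^sup>2"
    using assms by auto
  moreover have "0 \<le> W + q * M"
    using *
  proof
    assume "(4 * N - q / 8) * (d0 * d3) \<le> (7 / 4 * N - q / 8) * (d1 * d2)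
        \<and> 0 \<le> (N - q / 32) * (N - q / 2) * (d1\<^sup>2 - d0 * d2)"
    then show ?thesis using assms(1) by (simp add: W_def M_def)
  next
    assume A: "d0 * d3 \<le> d1 * d2 \<and> q \<le> 2 * N \<and>
        9 / 4 * q * N * (d1 * d2) \<le> (N - q / 32) * (N - q / 2) * (d1\<^sup>2 - d0 * d2)"
    then have "(4 * N - q / 8) * (d0 * d3) \<le> (4 * N - q / 8) * (d1 * d2)"
      using assms(2) by (intro mult_left_mono) auto
    then have "- (9 / 4 * N * (d1 * d2)) \<le> M"
      unfolding M_def by (simp add: algebra_simps)
    then have "q * - (9 / 4 * N * (d1 * d2)) \<le> q * M"
      using assms(1) by (intro mult_left_mono) auto
    then show ?thesis using A unfolding W_def by (simp add: algebra_simps)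
  qed
  ultimately show ?thesis by linarith
qed

lemma linear_le_power_of_two: "j \<ge> 6 \<Longrightarrow> 8 * (real j + 2) \<le> 2 ^ j"
  by (induction j rule: dec_induct) auto


text \<open>
  The coefficient with index \<open>k - 1\<close>, which is zero for \<open>k = 0\<close>.
\<close>

definition shifted_coeff :: "nat \<Rightarrow> nat \<Rightarrow> nat" where
  "shifted_coeff n k = (if k = 0 then 0 else ladder_coeff n (k - 1))"

text \<open>
  The closed form of the genus distribution, divided by \<open>2 ^ k\<close>.
\<close>

definition scaled_genus_number :: "nat \<Rightarrow> nat \<Rightarrow> real" where
  "scaled_genus_number n k = 4 ^ k * real (ladder_coeff n k) + (2 ^ n - 4 ^ k / 8) * real (shifted_coeff n k)"

text \<open>
  The middle index is \<open>k + 1\<close>, so \<open>j = n + 1 - 2 (k + 1)\<close>. Beyond the support of the coefficients, where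
  \<open>j\<close> would be negative, the last of the three numbers vanishes.
\<close>

lemma scaled_genus_number_log_concave:
  "scaled_genus_number n k * scaled_genus_number n (k + 2)
    \<le> (scaled_genus_number n (k + 1))\<^sup>2"
proof (cases "2 * (k + 1) \<le> n + 1")
  case False
  then have "scaled_genus_number n (k + 2) = 0"
    using ladder_coeff_eq_0[of n "k + 1"] ladder_coeff_eq_0[of n "k + 2"]
    by (simp add: scaled_genus_number_def shifted_coeff_def)
  then show ?thesis by simp
next
  case True
  then obtain j where j: "n + 1 = 2 * (k + 1) + j" by (metis le_Suc_ex)
  define q N where "q = (4 :: real) ^ (k + 1)" and "N = (2 :: real) ^ n"
  define d0 d1 d2 d3 where "d0 = real (shifted_coeff n k)" and "d1 = real (ladder_coeff n k)"
    and "d2 = real (ladder_coeff n (k + 1))" and "d3 = real (ladder_coeff n (k + 2))"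
  have q: "q > 0" and N: "N > 0" by (simp_all add: q_def N_def)
  have nn: "d0 \<ge> 0" "d1 \<ge> 0" "d2 \<ge> 0" "d3 \<ge> 0" by (simp_all add: d0_def d1_def d2_def d3_def)
  have "q * 2 ^ j = 2 * N"
  proof -
    have "q * 2 ^ j = 2 ^ (2 * (k + 1) + j)" by (simp add: q_def power_add power_mult)
    also have "\<dots> = 2 * N" unfolding j[symmetric] by (simp add: N_def)
    finally show ?thesis .
  qed
  then have q_le: "q * c \<le> 2 * N" if "c \<le> 2 ^ j" for c
    using mult_left_mono[OF that, of q] q by simp
  have q2: "q \<le> 2 * N" using q_le[of 1] by simp
  have lc0: "real (k + 1) * (d0 * d2) \<le> real k * d1\<^sup>2"
    using ladder_coeff_strict_log_concave[of "k - 1" n]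
    by (cases k) (auto simp: d0_def d1_def d2_def shifted_coeff_def)
  have lc: "d1 * d3 \<le> d2\<^sup>2"
  proof -
    have "real (k + 2) * (d1 * d3) \<le> real (k + 1) * d2\<^sup>2"
      using ladder_coeff_strict_log_concave[of k n] by (simp add: d1_def d2_def d3_def)
    also have "\<dots> \<le> real (k + 2) * d2\<^sup>2" by (intro mult_right_mono) auto
    finally show ?thesis by (rule mult_left_le_imp_le) simp
  qed
  have gap: "d1\<^sup>2 \<le> real (k + 1) * (d1\<^sup>2 - d0 * d2)"
    using lc0 by (simp add: algebra_simps)
  have gap0: "0 \<le> d1\<^sup>2 - d0 * d2"
    using order_trans[OF _ gap, of 0] by (simp add: zero_le_mult_iff)
  \<comment> \<open>For \<open>k = 0\<close> the left side vanishes, since \<open>d0 = 0\<close>.\<close>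
  have cross: "(real j + 4) * (real j + 3) * (d0 * d3) \<le> real j * (real j - 1) * (d1 * d2)"
  proof (cases k)
    case 0
    then show ?thesis using nn by (cases j) (auto simp: d0_def shifted_coeff_def)
  next
    case (Suc i)
    then show ?thesis
      using ladder_coeff_cross[of n i j] j
      by (simp add: d0_def d1_def d2_def d3_def shifted_coeff_def numeral_3_eq_3)
  qed
  \<comment> \<open>The threshold between the two regimes: \<open>8 * (j + 2) \<le> 2 ^ j\<close> holds from \<open>j = 6\<close> on.\<close>
  have main: "(4 * N - q / 8) * (d0 * d3) \<le> (7 / 4 * N - q / 8) * (d1 * d2)
        \<and> 0 \<le> (N - q / 32) * (N - q / 2) * (d1\<^sup>2 - d0 * d2)
      \<or> d0 * d3 \<le> d1 * d2 \<and> q \<le> 2 * N \<and>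
        9 / 4 * q * N * (d1 * d2) \<le> (N - q / 32) * (N - q / 2) * (d1\<^sup>2 - d0 * d2)"
  proof (cases "j \<le> 5")
    case True
    have "(4 * N - q / 8) * (d0 * d3) \<le> (7 / 4 * N - q / 8) * (d1 * d2)"
    proof (cases "j \<le> 1")
      case True
      then have "real j * (real j - 1) = 0" by auto
      with cross have "(real j + 4) * (real j + 3) * (d0 * d3) \<le> 0" by simp
      then have "d0 * d3 = 0" using nn by (auto simp: mult_le_0_iff)
      moreover have "0 \<le> (7 / 4 * N - q / 8) * (d1 * d2)"
        using nn q2 N by (intro mult_nonneg_nonneg) auto
      ultimately show ?thesis by (metis mult_zero_right)
    next
      case False
      with q_le[of 4] have q4: "q * 4 \<le> 2 * N"
        using power_increasing[of 2 j "2 :: real"] by simp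
      \<comment> \<open>The quotient \<open>j * (j - 1) / ((j + 4) * (j + 3))\<close> increases with \<open>j\<close>; at \<open>j = 5\<close> it is \<open>5 / 18\<close>.\<close>
      have "j \<in> {2, 3, 4, 5}" using True False by auto
      then have "18 * (d0 * d3) \<le> 5 * (d1 * d2)"
        using cross mult_nonneg_nonneg[OF nn(2,3)] by auto
      then have "(4 * N - q / 8) * (18 * (d0 * d3)) \<le> (4 * N - q / 8) * (5 * (d1 * d2))"
        using q2 N by (intro mult_left_mono) auto
      also have "\<dots> = ((4 * N - q / 8) * 5) * (d1 * d2)" by simp
      also have "\<dots> \<le> ((7 / 4 * N - q / 8) * 18) * (d1 * d2)"
        using q4 N q nn by (intro mult_right_mono) auto
      finally have "18 * ((4 * N - q / 8) * (d0 * d3)) \<le> 18 * ((7 / 4 * N - q / 8) * (d1 * d2))"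
        by (simp only: mult_ac)
      then show ?thesis by (rule mult_left_le_imp_le) simp
    qed
    moreover have "0 \<le> (N - q / 32) * (N - q / 2) * (d1\<^sup>2 - d0 * d2)"
      using q2 N gap0 by (intro mult_nonneg_nonneg) auto
    ultimately show ?thesis by blast
  next
    case False
    have "d0 * d3 \<le> d1 * d2"
    proof -
      have "(real j + 4) * (real j + 3) * (d0 * d3) \<le> (real j + 4) * (real j + 3) * (d1 * d2)"
        using cross by (rule order_trans) (use nn in \<open>auto intro!: mult_right_mono simp: algebra_simps\<close>)
      then show ?thesis by (rule mult_left_le_imp_le) simp
    qed
    moreover have "9 / 4 * q * N * (d1 * d2) \<le> (N - q / 32) * (N - q / 2) * (d1\<^sup>2 - d0 * d2)"
    proof -
      have growth: "real (k + 1) * d2 \<le> (real j + 2) * d1"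
        using ladder_coeff_growth[OF j] by (simp add: d1_def d2_def)
      have "q * (8 * (real j + 2)) \<le> 2 * N"
        using False by (intro q_le linear_le_power_of_two) simp
      then have qj: "q * (real j + 2) \<le> N / 4" by (simp add: algebra_simps)
      have q64: "q * 64 \<le> 2 * N"
        by (rule q_le) (use power_increasing[of 6 j "2 :: real"] False in simp)
      have "real (k + 1) * (9 / 4 * q * N * (d1 * d2)) = 9 / 4 * q * N * d1 * (real (k + 1) * d2)"
        by simp
      also have "\<dots> \<le> 9 / 4 * q * N * d1 * ((real j + 2) * d1)"
        using growth q N nn by (intro mult_left_mono) auto
      also have "\<dots> = 9 / 4 * N * (q * (real j + 2)) * d1\<^sup>2"
        by (simp add: power2_eq_square)
      also have "\<dots> \<le> 9 / 4 * N * (N / 4) * d1\<^sup>2"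
        using qj N by (intro mult_right_mono mult_left_mono) auto
      \<comment> \<open>Equality: the constant in \<open>8 * (j + 2)\<close> is chosen to make both sides \<open>9 / 16 * N\<^sup>2 * d1\<^sup>2\<close>.\<close>
      also have "\<dots> \<le> (3 / 4 * N) * (3 / 4 * N) * d1\<^sup>2"
        by (simp add: algebra_simps)
      also have "\<dots> \<le> (N - q / 32) * (N - q / 2) * d1\<^sup>2"
        using q64 N q by (intro mult_right_mono mult_mono) auto
      also have "\<dots> \<le> (N - q / 32) * (N - q / 2) * (real (k + 1) * (d1\<^sup>2 - d0 * d2))"
        using gap q64 N q by (intro mult_left_mono mult_nonneg_nonneg) auto
      finally have "real (k + 1) * (9 / 4 * q * N * (d1 * d2))
          \<le> real (k + 1) * ((N - q / 32) * (N - q / 2) * (d1\<^sup>2 - d0 * d2))"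
        by (simp add: mult_ac)
      then show ?thesis by (rule mult_left_le_imp_le) simp
    qed
    ultimately show ?thesis using q2 by blast
  qed
  have "scaled_genus_number n k = q / 4 * d1 + (N - q / 32) * d0" "scaled_genus_number n (k + 1) = q * d2 + (N - q / 8) * d1"
      "scaled_genus_number n (k + 2) = 4 * q * d3 + (N - q / 2) * d2"
    by (simp_all add: scaled_genus_number_def q_def N_def d0_def d1_def d2_def d3_def shifted_coeff_def)
  then show ?thesis
    using mixed_log_concave[OF _ _ lc nn(2,3) main] q N by simp
qed

section \<open>Closed form of the face counts\<close>

text \<open>
  Extending the coefficients by zero to negative \<open>k\<close> makes the recurrence \<open>weighted_coeff_Suc_Suc\<close> hold
  for all \<open>k\<close>.
\<close>

definition weighted_coeff :: "int \<Rightarrow> nat \<Rightarrow> int \<Rightarrow> int" where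
  "weighted_coeff c n k = (if k < 0 then 0 else c ^ nat k * int (ladder_coeff n (nat k)))"

lemma weighted_coeff_Suc_Suc:
  "weighted_coeff c (Suc (Suc n)) k = weighted_coeff c (Suc n) k + c * weighted_coeff c n (k - 1)"
proof (cases "k \<le> 0")
  case True
  then show ?thesis by (cases "k = 0") (auto simp: weighted_coeff_def)
next
  case False
  then obtain i where "k = int (Suc i)" by (metis not_le zero_less_imp_eq_int Suc_pred)
  then have "nat k = Suc i" "nat (k - 1) = i" "\<not> k < 0" "\<not> k - 1 < 0" by auto
  then show ?thesis by (simp add: weighted_coeff_def ladder_coeff_Suc_Suc algebra_simps)
qed

lemma weighted_coeff_0: "weighted_coeff c 0 k = (if k = 0 then 2 else 0)"
  by (cases "k = 0") (auto simp: weighted_coeff_def ladder_coeff_eq_0)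

lemma weighted_coeff_1: "weighted_coeff c (Suc 0) k = (if k = 0 then 2 else if k = 1 then c else 0)"
proof -
  consider "k < 0" | "k = 0" | "k = 1" | "2 \<le> k" by linarith
  then show ?thesis
  proof cases
    case 3
    then show ?thesis by (simp add: weighted_coeff_def ladder_coeff_def)
  next
    case 4
    then have "ladder_coeff (Suc 0) (nat k) = 0" by (intro ladder_coeff_eq_0) simp
    with 4 show ?thesis by (simp add: weighted_coeff_def)
  qed (simp_all add: weighted_coeff_def)
qed

text \<open>
  For fixed \<open>\<pi>\<close> and \<open>n\<close> all face numbers have the same parity, so that counting down from the maximum
  \<open>n + 2\<close> in steps of two reaches all of them.
\<close>

lemma swap_count_eq: "int (swap_count n (int n + 2 - 2 * k)) = 2 ^ n * weighted_coeff 2 n k"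
proof (induction n arbitrary: k rule: induct_nat_012)
  case 0
  show ?case by (auto simp: swap_count_0 weighted_coeff_0)
next
  case 1
  show ?case by (auto simp: swap_count_Suc swap_count_0 face_count_id_0 weighted_coeff_1)
next
  case (ge2 n)
  have "int (swap_count (Suc (Suc n)) (int (Suc (Suc n)) + 2 - 2 * k))
     = 8 * int (swap_count n (int n + 2 - 2 * (k - 1)))
       + 2 * int (swap_count (Suc n) (int (Suc n) + 2 - 2 * k))"
    by (simp add: swap_count_Suc_Suc algebra_simps)
  then show ?case unfolding ge2.IH weighted_coeff_Suc_Suc by (simp add: algebra_simps)
qed

text \<open>
  The solution of the homogeneous recurrence for \<open>spin_count\<close> has weight \<open>8\<close>. The term \<open>swap_count\<close> in
  the recurrence adds a solution of weight \<open>2\<close>, shifted by one.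
\<close>

lemma spin_count_eq:
  "int (spin_count n (int n + 3 - 2 * k))
    = weighted_coeff 8 n k - weighted_coeff 8 n (k - 1) + 2 * (2 ^ n * weighted_coeff 2 n (k - 1))"
proof (induction n arbitrary: k rule: induct_nat_012)
  case 0
  show ?case by (auto simp: spin_count_0 weighted_coeff_0)
next
  case 1
  show ?case by (auto simp: spin_count_Suc spin_count_0 swap_count_0 handle_count_0 weighted_coeff_1)
next
  case (ge2 n)
  have "int (spin_count (Suc (Suc n)) (int (Suc (Suc n)) + 3 - 2 * k))
     = 8 * int (spin_count n (int n + 3 - 2 * (k - 1)))
       + int (spin_count (Suc n) (int (Suc n) + 3 - 2 * k))
       + 2 * int (swap_count (Suc n) (int (Suc n) + 2 - 2 * (k - 1)))"
    by (simp add: spin_count_Suc_Suc algebra_simps)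
  then show ?case unfolding ge2.IH swap_count_eq weighted_coeff_Suc_Suc by (simp add: algebra_simps)
qed

lemma spin_count_eq_scaled:
  "real (spin_count n (int n + 3 - 2 * int k)) = 2 ^ k * scaled_genus_number n k"
proof -
  have eight: "(8 :: real) ^ i = 2 ^ i * 4 ^ i" for i
    by (simp flip: power_mult_distrib)
  have "real (spin_count n (int n + 3 - 2 * int k))
      = real_of_int (weighted_coeff 8 n (int k) - weighted_coeff 8 n (int k - 1)
          + 2 * (2 ^ n * weighted_coeff 2 n (int k - 1)))"
    by (simp flip: spin_count_eq)
  also have "\<dots> = 2 ^ k * scaled_genus_number n k"
  proof (cases k)
    case 0
    then show ?thesis by (simp add: weighted_coeff_def scaled_genus_number_def shifted_coeff_def)
  next
    case (Suc i)
    then have "int k = int i + 1" "nat (int i + 1) = Suc i" by auto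
    then show ?thesis by (simp add: weighted_coeff_def scaled_genus_number_def shifted_coeff_def Suc eight algebra_simps)
  qed
  finally show ?thesis .
qed

section \<open>The Ringel ladder\<close>

lemma verts_ringel_ladder:
  "verts (ringel_ladder n) = {(0, 0), (0, Suc n)} \<union> {0, 1} \<times> {1..n}"
  by (force simp: ringel_ladder_def add_new_edge_def symmetric_ladder_def contract_edge_def
      cartesian_product_def path_graph_def rung_def Let_def less_2_cases_iff)

lemma arcs_ringel_ladder:
  "arcs (ringel_ladder n) = (\<lambda>(i, s). strand_edge i s) ` ({0..n} \<times> UNIV) \<union> (Some \<circ> rung) ` {0<..n}"
proof -
  have "arcs (ringel_ladder n) = insert None (Some ` ({0} \<times> {i. i < n + 2} <+> {i. i < 2} \<times> {i. i < n + 1} - {rung 0} - {rung (n + 1)}))"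
    by (simp add: ringel_ladder_def add_new_edge_def symmetric_ladder_def contract_edge_def
        cartesian_product_def path_graph_def rung_def Let_def)
  also have "{0} \<times> {i. i < n + 2} <+> {i. i < 2} \<times> {i. i < n + 1} - {rung 0} - {rung (n + 1)}
      = rung ` {0<..n} \<union> Inr ` ({0, 1} \<times> {0..n})"
    by (auto simp: rung_def image_iff less_2_cases_iff)
  finally show ?thesis
    by (auto simp: UNIV_strand image_iff)
qed

lemma edge_ends_ringel_ladder: "edge_ends (ringel_ladder n) = ends_from 0 n"
  by (simp add: edge_ends_def ends_from_def arcs_ringel_ladder)

lemma card_verts_ringel_ladder: "card (verts (ringel_ladder n)) = 2 * n + 2"
proof -
  have "card ({(0 :: nat, 0), (0, Suc n)} \<union> {0, 1} \<times> {1..n}) = card {(0 :: nat, 0 :: nat), (0, Suc n)} + card ({0 :: nat, 1} \<times> {1..n})"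
    by (rule card_Un_disjoint) auto
  then show ?thesis by (simp add: verts_ringel_ladder card_cartesian_product)
qed

lemma card_arcs_ringel_ladder: "card (arcs (ringel_ladder n)) = 3 * n + 3"
proof -
  have "arcs (ringel_ladder n) = insert None ((Some \<circ> Inr) ` ({0, 1} \<times> {0..n}) \<union> (Some \<circ> rung) ` {0<..n})"
    by (auto simp: arcs_ringel_ladder UNIV_strand image_iff)
  moreover have "card ((Some \<circ> Inr) ` ({0, 1} \<times> {0..n}) \<union> (Some \<circ> rung) ` {0<..n}) =
     card ((Some \<circ> Inr :: nat \<times> nat \<Rightarrow> ladder_edge option) ` ({0, 1} \<times> {0..n}))
     + card ((Some \<circ> rung) ` {0<..n})"
    by (rule card_Un_disjoint) (auto simp: rung_def)
  moreover have "card ((Some \<circ> Inr :: nat \<times> nat \<Rightarrow> ladder_edge option) ` ({0, 1} \<times> {0..n})) = 2 * (n + 1)"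
    by (subst card_image) (auto simp: inj_on_def card_cartesian_product)
  moreover have "card ((Some \<circ> rung) ` {0<..n}) = n"
    by (subst card_image) (auto simp: inj_on_def)
  ultimately show ?thesis by (simp add: card_insert_if image_iff)
qed

abbreviation side :: "nat \<Rightarrow> strand" where
  "side i \<equiv> (if i = 0 then Upper else Lower)"

text \<open>
  The reference order at each vertex is chosen to agree with \<open>root_rotation\<close> and \<open>rung_rotation\<close>. At the
  positions \<open>0\<close> and \<open>n + 1\<close> along the ladder there is only one vertex, a root.
\<close>

definition corner1 :: "nat \<Rightarrow> ladder_vertex \<Rightarrow> ladder_end" where
  "corner1 n v = (if snd v = 0 then (strand_edge 0 Upper, False)
     else if snd v = Suc n then (strand_edge n Upper, True)
     else (strand_edge (snd v - 1) (side (fst v)), True))"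

definition corner2 :: "nat \<Rightarrow> ladder_vertex \<Rightarrow> ladder_end" where
  "corner2 n v = (if snd v = 0 then (strand_edge 0 Lower, False)
     else if snd v = Suc n then (strand_edge n Lower, True)
     else (strand_edge (snd v) (side (fst v)), False))"

definition corner3 :: "nat \<Rightarrow> ladder_vertex \<Rightarrow> ladder_end" where
  "corner3 n v = (if snd v = 0 then (strand_edge 0 Handle, False)
     else if snd v = Suc n then (strand_edge n Handle, True)
     else (Some (rung (snd v)), fst v \<noteq> 0))"

lemma end_vertex_ringel_ladder:
  assumes "d \<in> ends_from 0 n" "v \<in> {(0, 0), (0, Suc n)} \<union> {0, 1} \<times> {1..n}"
  shows "end_vertex (ringel_ladder n) d = v \<longleftrightarrow> d = corner1 n v \<or> d = corner2 n v \<or> d = corner3 n v"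
proof -
  obtain e b where d: "d = (e, b)" by (cases d)
  note defs = ringel_ladder_def add_new_edge_def symmetric_ladder_def contract_edge_def
        cartesian_product_def path_graph_def rung_def Let_def root_u_def root_v_def
        corner1_def corner2_def corner3_def
  consider i where "i \<le> n" "e = Some (Inr (0, i))" | i where "i \<le> n" "e = Some (Inr (1, i))"
    | "e = None" | i where "0 < i" "i \<le> n" "e = Some (Inl (0, i))"
    using assms(1) by (auto simp: d ends_from_def UNIV_strand rung_def)
  then show ?thesis
    using assms(2) unfolding d by cases (cases b; auto simp: defs)+
qed


interpretation ringel: trivalent "ringel_ladder n" "corner1 n" "corner2 n" "corner3 n" for n
proof
  fix d assume d: "d \<in> edge_ends (ringel_ladder n)"
  obtain e b where eb: "d = (e, b)" by (cases d)
  consider i where "i \<le> n" "e = Some (Inr (0, i))" | i where "i \<le> n" "e = Some (Inr (1, i))"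
    | "e = None" | i where "0 < i" "i \<le> n" "e = Some (Inl (0, i))"
    using d by (auto simp: eb edge_ends_ringel_ladder ends_from_def UNIV_strand rung_def)
  then show "end_vertex (ringel_ladder n) d \<in> verts (ringel_ladder n)"
    unfolding eb verts_ringel_ladder
    by cases (cases b; auto simp: ringel_ladder_def add_new_edge_def symmetric_ladder_def contract_edge_def
        cartesian_product_def path_graph_def rung_def Let_def root_u_def root_v_def)+
next
  fix v assume v: "v \<in> verts (ringel_ladder n)"
  have "{corner1 n v, corner2 n v, corner3 n v} \<subseteq> ends_from 0 n"
    using v by (auto simp: verts_ringel_ladder corner1_def corner2_def corner3_def strand_end_mem rung_end_mem
        simp del: strand_edge.simps)
  moreover have "d \<in> ends_at (ringel_ladder n) v \<longleftrightarrow> d \<in> ends_from 0 n \<and> d \<in> {corner1 n v, corner2 n v, corner3 n v}" for d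
    using end_vertex_ringel_ladder[of d n v] v
    unfolding ends_at_def edge_ends_ringel_ladder verts_ringel_ladder by blast
  ultimately show "ends_at (ringel_ladder n) v = {corner1 n v, corner2 n v, corner3 n v}"
    by blast
  show "distinct [corner1 n v, corner2 n v, corner3 n v]"
    using v by (auto simp: verts_ringel_ladder corner1_def corner2_def corner3_def)
qed

lemma tail_rotation_iff:
  "tail_rotation \<rho> j cs y \<longleftrightarrow>
     (\<forall>i < length cs. rung_rotation \<rho> (j + i) (cs ! i)) \<and> root_rotation \<rho> (j + length cs) True y"
proof (induction cs arbitrary: j)
  case (Cons c cs)
  then show ?case by (auto simp: less_Suc_eq_0_disj)
qed simp

text \<open>
  A code lists the bit of the left root, the bits of the rungs, and the bit of the right root.
\<close>

definition encodes :: "(ladder_end \<Rightarrow> ladder_end) \<Rightarrow> bool \<times> (bool \<times> bool) list \<times> bool \<Rightarrow> bool" where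
  "encodes \<rho> = (\<lambda>(x, cs, y). root_rotation \<rho> 0 False x \<and> tail_rotation \<rho> 0 cs y)"

definition bit_at :: "bool \<times> (bool \<times> bool) list \<times> bool \<Rightarrow> ladder_vertex \<Rightarrow> bool" where
  "bit_at = (\<lambda>(x, cs, y) (i, k). if k = 0 then x else if k = Suc (length cs) then y
     else if i = 0 then fst (cs ! (k - 1)) else snd (cs ! (k - 1)))"

lemma encodes_iff:
  assumes "length cs = n"
  shows "encodes \<rho> (x, cs, y) \<longleftrightarrow>
    (\<forall>v \<in> verts (ringel_ladder n). turns \<rho> (corner1 n v) (corner2 n v) (corner3 n v) (bit_at (x, cs, y) v))"
proof -
  have verts: "(\<forall>v \<in> verts (ringel_ladder n). P v) \<longleftrightarrow>
      P (0, 0) \<and> P (0, Suc n) \<and> (\<forall>i < n. P (0, Suc i) \<and> P (1, Suc i))" for P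
  proof
    assume *: "P (0, 0) \<and> P (0, Suc n) \<and> (\<forall>i < n. P (0, Suc i) \<and> P (1, Suc i))"
    have "P (j, k)" if "j \<in> {0, 1}" "k \<in> {1..n}" for j k
      using that * by (cases k) auto
    with * show "\<forall>v \<in> verts (ringel_ladder n). P v"
      unfolding verts_ringel_ladder by blast
  qed (auto simp: verts_ringel_ladder)
  show ?thesis
    using assms unfolding verts
    by (auto simp: encodes_def tail_rotation_iff root_rotation_def rung_rotation_def
        bit_at_def corner1_def corner2_def corner3_def simp del: strand_edge.simps)
qed

lemma encodes_unique_code:
  assumes "encodes \<rho> (x, cs, y)" "encodes \<rho> (x', cs', y')" "length cs = n" "length cs' = n"
  shows "(x, cs, y) = (x', cs', y')"
proof -
  have eq: "bit_at (x, cs, y) v = bit_at (x', cs', y') v" if "v \<in> verts (ringel_ladder n)" for v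
    using assms(1,2) that
    unfolding encodes_iff[OF assms(3)] encodes_iff[OF assms(4)]
    by (intro turns_unique[OF _ _ ringel.distinct_ends[OF that]]) auto
  have "cs ! i = cs' ! i" if "i < n" for i
    using eq[of "(0, Suc i)"] eq[of "(1, Suc i)"] that assms(3,4)
    by (auto simp: verts_ringel_ladder bit_at_def prod_eq_iff)
  then have "cs = cs'" using assms(3,4) by (auto intro: nth_equalityI)
  moreover have "x = x'" "y = y'"
    using eq[of "(0, 0)"] eq[of "(0, Suc n)"] assms(3,4) by (auto simp: verts_ringel_ladder bit_at_def)
  ultimately show ?thesis by simp
qed

lemma encodes_exists_code:
  assumes "rotation_system (ringel_ladder n) \<rho>"
  shows "\<exists>x cs y. length cs = n \<and> encodes \<rho> (x, cs, y)"
proof -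
  obtain \<beta> where \<beta>: "\<And>v. v \<in> verts (ringel_ladder n) \<Longrightarrow> turns \<rho> (corner1 n v) (corner2 n v) (corner3 n v) (\<beta> v)"
    using ringel.rotation_system_turns[OF assms] by metis
  define cs where "cs = map (\<lambda>i. (\<beta> (0, Suc i), \<beta> (1, Suc i))) [0..<n]"
  have len: "length cs = n" by (simp add: cs_def)
  have "bit_at (\<beta> (0, 0), cs, \<beta> (0, Suc n)) v = \<beta> v" if "v \<in> verts (ringel_ladder n)" for v
    using that by (auto simp: verts_ringel_ladder bit_at_def cs_def)
  then have "encodes \<rho> (\<beta> (0, 0), cs, \<beta> (0, Suc n))"
    unfolding encodes_iff[OF len] using \<beta> by simp
  with len show ?thesis by blast
qed

text \<open>
  The left root starts the face tracing with \<open>\<pi> = spin x\<close>, and Euler's formula turns faces into genus.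
\<close>

lemma embeds_in_genus_iff:
  assumes rot: "rotation_system (ringel_ladder n) \<rho>" and enc: "encodes \<rho> (x, cs, y)" and len: "length cs = n"
  shows "embeds_in_genus (ringel_ladder n) \<rho> k \<longleftrightarrow>
    int (face_number (spin x) cs y) = int n + 3 - 2 * int k"
proof -
  have opp: "\<rho> \<circ> opposite_end \<circ> opposite_end = \<rho>"
    by (rule ext) (auto simp: split_paired_all)
  have "bij_betw opposite_end (ends_from 0 n) (ends_from 0 n)"
    unfolding edge_ends_ringel_ladder[symmetric]
    by (rule bij_betw_byWitness[where f' = opposite_end]) (auto simp: edge_ends_def)
  moreover have "bij_betw \<rho> (ends_from 0 n) (ends_from 0 n)"
    using rot permutes_imp_bij by (auto simp: rotation_system_def edge_ends_ringel_ladder)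
  ultimately have bij: "bij_betw (\<rho> \<circ> opposite_end) (ends_from 0 n) (ends_from 0 n)"
    by (rule bij_betw_trans)
  have start: "(\<rho> \<circ> opposite_end) (strand_edge 0 s, True) = (strand_edge 0 (spin x s), False)" for s
    using enc by (cases s) (auto simp: encodes_def root_rotation_def turns_def split: if_splits)
  have "cycle_count (\<rho> \<circ> opposite_end) (ends_from 0 n) = face_number (spin x) cs y"
    using len enc
    by (intro cycle_count_ends_from bij bij_spin start) (simp_all add: encodes_def opp)
  then have "card (faces (ringel_ladder n) \<rho>) = face_number (spin x) cs y"
    by (simp add: faces_def cycle_count_def edge_ends_ringel_ladder)
  then show ?thesis
    unfolding embeds_in_genus_def card_verts_ringel_ladder card_arcs_ringel_ladder by auto
qed

lemma genus_distribution_ringel_ladder: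
  "genus_distribution (ringel_ladder n) k = spin_count n (int n + 3 - 2 * int k)"
proof -
  let ?m = "int n + 3 - 2 * int k"
  let ?C = "{(x, cs, y). length cs = n \<and> int (face_number (spin x) cs y) = ?m}"
  let ?R = "{\<rho>. rotation_system (ringel_ladder n) \<rho> \<and> embeds_in_genus (ringel_ladder n) \<rho> k}"
  define f where "f c = (SOME \<rho>. rotation_system (ringel_ladder n) \<rho> \<and> encodes \<rho> c)" for c
  have f: "rotation_system (ringel_ladder n) (f (x, cs, y)) \<and> encodes (f (x, cs, y)) (x, cs, y)"
    if "length cs = n" for x cs y
  proof -
    have "\<exists>\<rho>. rotation_system (ringel_ladder n) \<rho> \<and> encodes \<rho> (x, cs, y)"
      unfolding encodes_iff[OF that]
      by (rule ringel.rotation_system_exists) (simp add: edge_ends_ringel_ladder finite_ends_from)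
    then show ?thesis unfolding f_def by (rule someI_ex)
  qed
  have "bij_betw f ?C ?R"
    unfolding bij_betw_def
  proof
    show "inj_on f ?C"
      using f encodes_unique_code by (intro inj_onI) (clarsimp, metis)
    show "f ` ?C = ?R"
    proof (intro equalityI subsetI)
      fix \<rho> assume "\<rho> \<in> f ` ?C"
      then obtain x cs y where c: "length cs = n" "int (face_number (spin x) cs y) = ?m" "\<rho> = f (x, cs, y)"
        by blast
      then show "\<rho> \<in> ?R"
        using f[OF c(1), of x y] embeds_in_genus_iff[of n "f (x, cs, y)" x cs y k] by simp
    next
      fix \<rho> assume \<rho>: "\<rho> \<in> ?R"
      then obtain x cs y where c: "length cs = n" "encodes \<rho> (x, cs, y)"
        using encodes_exists_code by blast
      have "f (x, cs, y) = \<rho>"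
        using f[OF c(1), of x y] \<rho> c encodes_iff[OF c(1)] ringel.rotation_system_eqI[of n _ _ "bit_at (x, cs, y)"]
        by auto
      moreover have "(x, cs, y) \<in> ?C"
        using embeds_in_genus_iff[OF _ c(2,1)] \<rho> c(1) by auto
      ultimately show "\<rho> \<in> f ` ?C" by force
    qed
  qed
  then have "genus_distribution (ringel_ladder n) k = card ?C"
    by (simp add: genus_distribution_def bij_betw_same_card)
  also have "?C = (\<Union>x \<in> UNIV. {x} \<times> {(cs, y). length cs = n \<and> int (face_number (spin x) cs y) = ?m})"
    by auto
  also have "card \<dots> = (\<Sum>x \<in> UNIV. face_count (spin x) n ?m)"
    by (subst card_UN_disjoint) (auto simp: finite_codes card_cartesian_product_singleton face_count_def)
  finally show ?thesis by (simp add: UNIV_bool spin_count_def)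
qed

theorem theorem5p3:
  fixes n :: nat
  shows "log_concave (genus_distribution (ringel_ladder n))"
  unfolding log_concave_def
proof (intro allI impI)
  fix k :: nat assume "1 \<le> k"
  then obtain i where k: "k = i + 1" by (metis le_add_diff_inverse2)
  let ?g = "genus_distribution (ringel_ladder n)"
  have g: "real (?g j) = 2 ^ j * scaled_genus_number n j" for j
    unfolding genus_distribution_ringel_ladder by (rule spin_count_eq_scaled)
  have "real (?g i * ?g (i + 2)) = (2 ^ (i + 1))\<^sup>2 * (scaled_genus_number n i * scaled_genus_number n (i + 2))"
    by (simp add: g power2_eq_square power_add)
  also have "\<dots> \<le> (2 ^ (i + 1))\<^sup>2 * (scaled_genus_number n (i + 1))\<^sup>2"
    by (intro mult_left_mono scaled_genus_number_log_concave) simp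
  also have "\<dots> = real ((?g (i + 1))\<^sup>2)"
    by (simp add: g power_mult_distrib)
  finally show "?g (k - 1) * ?g (k + 1) \<le> (?g k)\<^sup>2"
    unfolding of_nat_le_iff by (simp add: k)
qed

end
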